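(* Let $n\ge 3$, $K\ge 1$, let $\Omega\subset\mathbb R^n$ be a bounded domain, and let $p\in\left(1,\frac{nK}{K+1}\right)$. Then there exists a mapping $$f\in W^{1,p}(\Omega;\mathbb R^n)\cap C(\Omega;\mathbb R^n)\cap L^\infty(\Omega;\mathbb R^n)$$ which is weakly $K$-quasiregular but is not quasiregular (i.e. $f$ is not $K'$-quasiregular for any $K'\ge 1$).
   Context: For an open set $\Omega\subset\mathbb R^n$ and $f\in W^{1,p}_{\mathrm{loc}}(\Omega;\mathbb R^n)$ with $p\ge 1$, let $Df$ be the distributional (weak) gradient and $J_f=\det Df$ the Jacobian determinant. The mapping $f$ is called weakly $K$-quasiregular ($K\ge1$) if $f\in W^{1,1}_{\mathrm{loc}}(\Omega;\mathbb R^n)$, either $J_f\ge 0$ a.e. in $\Omega$ or $J_f\le 0$ a.e. in $\Omega$, and $$\max_{\xi\in\mathbb S^{n-1}}|Df(x)\xi|\le K\min_{\xi\in\mathbb S^{n-1}}|Df(x)\xi|\quad\text{for a.e. }x\in\Omega.$$ A weakly $K$-quasiregular mapping that additionally belongs to $W^{1,n}_{\mathrm{loc}}(\Omega;\mathbb R^n)$ is called $K$-quasiregular; a mapping is quasiregular if it is $K$-quasiregular for some $K\ge1$. *)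

theory Defs
  imports "HOL-Analysis.Analysis"
begin

definition partial_deriv :: "(real^'n \<Rightarrow> real) \<Rightarrow> 'n \<Rightarrow> real^'n \<Rightarrow> real" where
  "partial_deriv \<phi> j x = frechet_derivative \<phi> (at x) (axis j 1)"

coinductive smooth_fun :: "(real^'n \<Rightarrow> real) \<Rightarrow> bool" where
  "(\<forall>x. \<phi> differentiable (at x)) \<Longrightarrow> (\<forall>j. smooth_fun (partial_deriv \<phi> j)) \<Longrightarrow> smooth_fun \<phi>"

definition test_fun :: "(real^'n) set \<Rightarrow> (real^'n \<Rightarrow> real) \<Rightarrow> bool" where
  "test_fun \<Omega> \<phi> \<longleftrightarrow> smooth_fun \<phi> \<and> compact (closure {x. \<phi> x \<noteq> 0}) \<and> closure {x. \<phi> x \<noteq> 0} \<subseteq> \<Omega>"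

text \<open>G is a weak (distributional) gradient of f on Omega, f in W^{1,1}_loc:
  G x $ i $ j = partial_j f_i (x), so Df(x) xi = G x *v xi.\<close>
definition weak_grad :: "(real^'n \<Rightarrow> real^'n) \<Rightarrow> (real^'n \<Rightarrow> real^'n^'n) \<Rightarrow> (real^'n) set \<Rightarrow> bool" where
  "weak_grad f G \<Omega> \<longleftrightarrow>
     (\<forall>C. compact C \<and> C \<subseteq> \<Omega> \<longrightarrow> f absolutely_integrable_on C \<and> G absolutely_integrable_on C) \<and>
     (\<forall>\<phi>. test_fun \<Omega> \<phi> \<longrightarrow> (\<forall>i j.
        integral \<Omega> (\<lambda>x. f x $ i * partial_deriv \<phi> j x) = - integral \<Omega> (\<lambda>x. G x $ i $ j * \<phi> x)))"

definition Lp_on :: "real \<Rightarrow> (real^'n) set \<Rightarrow> (real^'n \<Rightarrow> 'b::euclidean_space) \<Rightarrow> bool" where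
  "Lp_on p S g \<longleftrightarrow> g measurable_on S \<and> (\<lambda>x. norm (g x) powr p) integrable_on S"

definition sobolev :: "real \<Rightarrow> (real^'n) set \<Rightarrow> (real^'n \<Rightarrow> real^'n) \<Rightarrow> bool" where
  "sobolev p \<Omega> f \<longleftrightarrow> (\<exists>G. weak_grad f G \<Omega> \<and> Lp_on p \<Omega> f \<and> Lp_on p \<Omega> G)"

definition sobolev_loc :: "real \<Rightarrow> (real^'n) set \<Rightarrow> (real^'n \<Rightarrow> real^'n) \<Rightarrow> bool" where
  "sobolev_loc p \<Omega> f \<longleftrightarrow> (\<exists>G. weak_grad f G \<Omega> \<and>
     (\<forall>C. compact C \<and> C \<subseteq> \<Omega> \<longrightarrow> Lp_on p C f \<and> Lp_on p C G))"

definition weakly_qr :: "real \<Rightarrow> (real^'n) set \<Rightarrow> (real^'n \<Rightarrow> real^'n) \<Rightarrow> bool" where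
  "weakly_qr K \<Omega> f \<longleftrightarrow> K \<ge> 1 \<and> (\<exists>G. weak_grad f G \<Omega> \<and>
     ((AE x in lebesgue. x \<in> \<Omega> \<longrightarrow> det (G x) \<ge> 0) \<or> (AE x in lebesgue. x \<in> \<Omega> \<longrightarrow> det (G x) \<le> 0)) \<and>
     (AE x in lebesgue. x \<in> \<Omega> \<longrightarrow>
        (\<forall>\<xi> \<eta>. norm \<xi> = 1 \<and> norm \<eta> = 1 \<longrightarrow> norm (G x *v \<xi>) \<le> K * norm (G x *v \<eta>))))"

definition quasiregular_K :: "real \<Rightarrow> (real^'n) set \<Rightarrow> (real^'n \<Rightarrow> real^'n) \<Rightarrow> bool" where
  "quasiregular_K K \<Omega> f \<longleftrightarrow> weakly_qr K \<Omega> f \<and> sobolev_loc (real CARD('n)) \<Omega> f"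

definition quasiregular :: "(real^'n) set \<Rightarrow> (real^'n \<Rightarrow> real^'n) \<Rightarrow> bool" where
  "quasiregular \<Omega> f \<longleftrightarrow> (\<exists>K\<ge>1. quasiregular_K K \<Omega> f)"

end

theory Submission
  imports Defs
begin

text \<open>
The radial map \<open>x |x| powr (- 1 - 1/K)\<close> reverses orientation, has linear dilatation \<open>K\<close>, and its gradient
is in \<open>L\<^sup>p\<close> exactly for \<open>p < nK/(K+1)\<close>, but it is unbounded. Stop it at radius 1/2 and continue it linearly:
the result is the identity on the unit sphere and \<open>\<Lambda> x\<close> on the inner ball, with \<open>\<Lambda> = 2 powr (1 + 1/K)\<close>.
The inner map has the wrong orientation, so the inner ball is filled up to a null set by tiny disjoint balls,
and on each of them the linear map is replaced by a rescaled copy of the whole construction. The set where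
the orientation is wrong shrinks by the factor \<open>2\<^sup>-\<^sup>n\<close> in each step while the gradient there grows by the factor
\<open>\<Lambda>\<close>; hence the \<open>L\<^sup>p\<close> norms converge geometrically. Since the balls are tiny, the maps converge uniformly.
The limit gradient satisfies a self-similarity relation which forces its \<open>L\<^sup>n\<close> norm on each ball to be infinite.
Finally \<open>\<Omega>\<close> itself is filled by balls carrying copies of the limit.
\<close>

section \<open>Weak derivatives tested against C1 functions\<close>

text \<open>All exponents come from one count. A generation multiplies the integral of the p-th
  power of the gradient by \<open>\<Lambda> powr p\<close> times 2^-n, and this factor is below 1
  iff (1 + 1/K) p < n, which is the hypothesis p < nK/(K+1). For p = n it equals 2^(n/K) > 1, so the
  integral diverges. For p = 1 it is at most 4/8, because \<Lambda> \<le> 4 and n \<ge> 3; this is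
  what makes the series of gradients converge in L1. The power 1 + 1/K is dictated by the derivative
  |x|^-\<alpha> (I - \<alpha> e e^T), e = x/|x|, of x |x|^-\<alpha>: it stretches by 1 tangentially
  and by 1 - \<alpha> = -1/K radially. The gradient of the limit is unbounded, so the limit is not
  treated as a Lipschitz map. Every map is written as the identity plus a correction vanishing
  outside the unit ball. Pasting a copy then means adding a function extended by zero, no boundary
  terms arise, the limit becomes a series, and only the first block has to be differentiated
  classically. Quasiregularity asks for some weak gradient in L^n, not for the constructed one;
  uniqueness of weak gradients closes that gap.\<close>

text \<open>Testing with C1 functions instead of smooth ones makes affine rescaling of test functions immediate.\<close>

definition C1_test :: "(real^'n \<Rightarrow> real) \<Rightarrow> (real^'n \<Rightarrow> real^'n) \<Rightarrow> bool" where
  "C1_test \<phi> D \<longleftrightarrow> (\<forall>x. (\<phi> has_derivative (\<lambda>h. D x \<bullet> h)) (at x)) \<and> continuous_on UNIV D \<and>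
     (\<exists>R. \<forall>x. norm x > R \<longrightarrow> \<phi> x = 0 \<and> D x = 0)"

lemma smooth_fun_differentiable: "smooth_fun \<phi> \<Longrightarrow> \<phi> differentiable (at x)"
  by (erule smooth_fun.cases) auto

lemma smooth_fun_partial_deriv: "smooth_fun \<phi> \<Longrightarrow> smooth_fun (partial_deriv \<phi> j)"
  by (erule smooth_fun.cases) auto

lemma frechet_derivative_eq_gradient:
  fixes \<phi> :: "real^'n \<Rightarrow> real"
  assumes "\<phi> differentiable (at x)"
  shows "(\<phi> has_derivative (\<lambda>h. (\<chi> j. partial_deriv \<phi> j x) \<bullet> h)) (at x)"
proof -
  let ?F = "frechet_derivative \<phi> (at x)"
  have d: "(\<phi> has_derivative ?F) (at x)"
    using assms frechet_derivative_works by blast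
  then have lin: "linear ?F" by (rule has_derivative_linear)
  have "?F h = (\<chi> j. partial_deriv \<phi> j x) \<bullet> h" for h
  proof -
    have "?F h = ?F (\<Sum>j\<in>UNIV. h $ j *\<^sub>R axis j 1)"
      using basis_expansion[of h] by (simp add: scalar_mult_eq_scaleR)
    also have "\<dots> = (\<Sum>j\<in>UNIV. h $ j * ?F (axis j 1))"
      using lin by (simp add: linear_sum linear_scale)
    finally show ?thesis
      by (simp add: inner_vec_def partial_deriv_def mult.commute)
  qed
  then have "?F = (\<lambda>h. (\<chi> j. partial_deriv \<phi> j x) \<bullet> h)" by blast
  with d show ?thesis by metis
qed

text \<open>Unfolding the coinductive smoothness twice suffices: the partial derivatives are
  themselves differentiable, hence continuous. The second claim, vanishing of the gradient off the
  closed support, later allows integrals over \<Omega> to be replaced by integrals over the whole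
  space.\<close>

lemma test_fun_C1_test:
  assumes "test_fun \<Omega> \<phi>"
  shows "C1_test \<phi> (\<lambda>x. \<chi> j. partial_deriv \<phi> j x)"
    and "\<And>x. x \<notin> closure {x. \<phi> x \<noteq> 0} \<Longrightarrow> (\<chi> j. partial_deriv \<phi> j x) = 0"
proof -
  let ?S = "closure {x. \<phi> x \<noteq> 0}"
  let ?D = "\<lambda>x. \<chi> j. partial_deriv \<phi> j x"
  have s: "smooth_fun \<phi>" and c: "compact ?S"
    using assms by (auto simp: test_fun_def)
  have der: "(\<phi> has_derivative (\<lambda>h. ?D x \<bullet> h)) (at x)" for x
    using s frechet_derivative_eq_gradient smooth_fun_differentiable by blast
  have cont: "continuous_on UNIV ?D"
    by (intro continuous_on_vec_lambda continuous_at_imp_continuous_on ballI differentiable_imp_continuous_within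
        smooth_fun_differentiable smooth_fun_partial_deriv s)
  show D0: "?D x = 0" if "x \<notin> ?S" for x
  proof -
    have "(\<phi> has_derivative (\<lambda>h. 0)) (at x)"
    proof (rule has_derivative_transform_within_open)
      show "((\<lambda>_. 0) has_derivative (\<lambda>h. 0)) (at x)" by simp
      show "open (- ?S)" by (simp add: open_Compl)
      show "x \<in> - ?S" using that by simp
      show "0 = \<phi> y" if "y \<in> - ?S" for y
        using that closure_subset[of "{x. \<phi> x \<noteq> 0}"] by auto
    qed
    then have "(\<lambda>h. ?D x \<bullet> h) = (\<lambda>h. 0)"
      using der has_derivative_unique by blast
    then show ?thesis by (metis inner_eq_zero_iff)
  qed
  obtain R where R: "\<And>x. x \<in> ?S \<Longrightarrow> norm x \<le> R"
    using c compact_imp_bounded bounded_iff by metis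
  have "\<phi> x = 0 \<and> ?D x = 0" if "norm x > R" for x
  proof -
    have "x \<notin> ?S" using R that by fastforce
    then show ?thesis
      using D0 closure_subset[of "{x. \<phi> x \<noteq> 0}"] by blast
  qed
  then show "C1_test \<phi> ?D"
    using der cont unfolding C1_test_def by blast
qed

lemma C1_test_affine:
  assumes "C1_test \<phi> D" "r > 0"
  shows "C1_test (\<lambda>x. \<phi> (a + r *\<^sub>R x)) (\<lambda>x. r *\<^sub>R D (a + r *\<^sub>R x))"
proof -
  have der: "\<And>x. (\<phi> has_derivative (\<lambda>h. D x \<bullet> h)) (at x)" and cont: "continuous_on UNIV D"
    using assms by (auto simp: C1_test_def)
  obtain R where R: "\<And>x. norm x > R \<Longrightarrow> \<phi> x = 0 \<and> D x = 0"
    using assms unfolding C1_test_def by auto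
  have 1: "((\<lambda>x. \<phi> (a + r *\<^sub>R x)) has_derivative (\<lambda>h. r *\<^sub>R D (a + r *\<^sub>R x) \<bullet> h)) (at x)" for x
    by (rule has_derivative_eq_rhs[OF has_derivative_compose[OF _ der]])
       (auto intro!: derivative_eq_intros)
  have 2: "continuous_on UNIV (\<lambda>x. r *\<^sub>R D (a + r *\<^sub>R x))"
    by (intro continuous_intros continuous_on_compose2[OF cont]) auto
  have "norm (a + r *\<^sub>R x) > R" if "norm x > (R + norm a) / r" for x
  proof -
    have "r * norm x > R + norm a"
      using that assms(2) by (simp add: field_simps)
    moreover have "r * norm x \<le> norm (a + r *\<^sub>R x) + norm a"
      using norm_triangle_ineq4[of "a + r *\<^sub>R x" a] assms(2) by simp
    ultimately show ?thesis by linarith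
  qed
  then have "\<forall>x. norm x > (R + norm a) / r \<longrightarrow> \<phi> (a + r *\<^sub>R x) = 0 \<and> r *\<^sub>R D (a + r *\<^sub>R x) = 0"
    using R by simp
  with 1 2 show ?thesis unfolding C1_test_def by blast
qed

lemma C1_test_continuous:
  assumes "C1_test \<phi> D"
  shows "continuous_on UNIV \<phi>" "continuous_on UNIV D"
proof -
  show "continuous_on UNIV \<phi>"
    unfolding continuous_on_eq_continuous_within
    using assms has_derivative_continuous[of \<phi>] unfolding C1_test_def by blast
  show "continuous_on UNIV D"
    using assms by (simp add: C1_test_def)
qed

lemma C1_test_measurable:
  assumes "C1_test \<phi> D"
  shows "\<phi> \<in> borel_measurable borel" "D \<in> borel_measurable borel"
  using C1_test_continuous[OF assms] by (auto intro: borel_measurable_continuous_onI)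

lemma continuous_zero_outside_bounded:
  fixes f :: "real^'n \<Rightarrow> 'b::euclidean_space"
  assumes "continuous_on UNIV f" "\<And>x. norm x > R \<Longrightarrow> f x = 0"
  obtains M where "M \<ge> 0" "\<And>x. norm (f x) \<le> M"
proof -
  have "compact (f ` cball 0 R)"
    using assms(1) by (intro compact_continuous_image) (auto intro: continuous_on_subset)
  then obtain M where M: "\<And>x. x \<in> cball 0 R \<Longrightarrow> norm (f x) \<le> M"
    using compact_imp_bounded bounded_iff by (metis image_eqI)
  have "norm (f x) \<le> max M 0" for x
    using M[of x] assms(2)[of x] by (cases "norm x \<le> R") auto
  then show ?thesis using that[of "max M 0"] by auto
qed

lemma C1_test_bounded:
  assumes "C1_test \<phi> D"
  obtains M R where "M \<ge> 0" "\<And>x. \<bar>\<phi> x\<bar> \<le> M" "\<And>x. norm (D x) \<le> M"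
    "\<And>x. norm x > R \<Longrightarrow> \<phi> x = 0" "\<And>x. norm x > R \<Longrightarrow> D x = 0"
proof -
  obtain R where R: "\<And>x. norm x > R \<Longrightarrow> \<phi> x = 0 \<and> D x = 0"
    using assms unfolding C1_test_def by auto
  obtain M1 where "M1 \<ge> 0" "\<And>x. norm (\<phi> x) \<le> M1"
    using continuous_zero_outside_bounded[OF C1_test_continuous(1)[OF assms]] R by metis
  moreover obtain M2 where "M2 \<ge> 0" "\<And>x. norm (D x) \<le> M2"
    using continuous_zero_outside_bounded[OF C1_test_continuous(2)[OF assms]] R by metis
  ultimately show ?thesis
    using that[of "max M1 M2" R] R
    by (metis le_max_iff_disj max.coboundedI1 real_norm_def)
qed

lemma C1_test_lipschitz:
  assumes "C1_test \<phi> D" "\<And>x. norm (D x) \<le> M"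
  shows "\<bar>\<phi> x - \<phi> y\<bar> \<le> M * norm (x - y)"
proof -
  have "norm (\<phi> x - \<phi> y) \<le> M * norm (x - y)"
  proof (rule differentiable_bound[of UNIV])
    fix z :: "real^'a"
    show "(\<phi> has_derivative (\<lambda>h. D z \<bullet> h)) (at z within UNIV)"
      using assms(1) by (auto simp: C1_test_def)
    show "onorm ((\<bullet>) (D z)) \<le> M"
    proof (rule onorm_le)
      fix h
      have "norm (D z \<bullet> h) \<le> norm (D z) * norm h"
        using Cauchy_Schwarz_ineq2[of "D z" h] by simp
      also have "\<dots> \<le> M * norm h"
        using assms(2) by (intro mult_right_mono) auto
      finally show "norm (D z \<bullet> h) \<le> M * norm h" .
    qed
  qed auto
  then show ?thesis by simp
qed

section \<open>Weak derivatives in matrix form\<close>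

definition outer :: "real^'n \<Rightarrow> real^'m \<Rightarrow> real^'m^'n" where
  "outer v d = (\<chi> i j. v $ i * d $ j)"

lemma outer_nth: "outer v d $ i $ j = v $ i * d $ j"
  by (simp add: outer_def)

lemma norm_outer: "norm (outer v d) = norm v * norm d"
proof -
  have "outer v d $ i = v $ i *\<^sub>R d" for i
    by (simp add: vec_eq_iff outer_nth)
  then have "norm (outer v d) = L2_set (\<lambda>i. norm (v $ i) * norm d) UNIV"
    by (simp add: norm_vec_def[of "outer v d"])
  also have "\<dots> = norm v * norm d"
    by (simp add: L2_set_left_distrib[symmetric] norm_vec_def[of v])
  finally show ?thesis .
qed

lemma bounded_bilinear_outer: "bounded_bilinear outer"
proof
  show "\<exists>K. \<forall>a b. norm (outer a b) \<le> norm a * norm b * K"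
    by (rule exI[of _ 1]) (simp add: norm_outer)
qed (auto simp: vec_eq_iff outer_nth algebra_simps)

text \<open>The rank-one matrix \<open>outer (v x) (D x)\<close> collects all products of a
  component of v with a partial derivative of the test function, so a single Bochner identity
  replaces one scalar identity per entry. Integrability is not part of the notion and is carried
  separately.\<close>

definition weak_der :: "(real^'n \<Rightarrow> real^'n) \<Rightarrow> (real^'n \<Rightarrow> real^'n^'n) \<Rightarrow> bool" where
  "weak_der v V \<longleftrightarrow> (\<forall>\<phi> D. C1_test \<phi> D \<longrightarrow>
     (\<integral>x. outer (v x) (D x) \<partial>lborel) = - (\<integral>x. \<phi> x *\<^sub>R V x \<partial>lborel))"

section \<open>Affine changes of variables and local integrability\<close>

lemma lborel_nn_integral_affine:
  fixes f :: "'a::euclidean_space \<Rightarrow> ennreal"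
  assumes [measurable]: "f \<in> borel_measurable borel" and "r > 0"
  shows "(\<integral>\<^sup>+x. f x \<partial>lborel) = ennreal (r ^ DIM('a)) * (\<integral>\<^sup>+x. f (t + r *\<^sub>R x) \<partial>lborel)"
  using assms(2)
  by (subst lborel_affine[of r t])
     (auto simp: nn_integral_density nn_integral_distr nn_integral_cmult)

lemma lborel_integral_affine:
  fixes f :: "'a::euclidean_space \<Rightarrow> 'b::{banach, second_countable_topology}"
  assumes [measurable]: "f \<in> borel_measurable borel" and "r > 0"
  shows "(\<integral>x. f x \<partial>lborel) = (r ^ DIM('a)) *\<^sub>R (\<integral>x. f (t + r *\<^sub>R x) \<partial>lborel)"
proof -
  have "(\<integral>x. f x \<partial>lborel) = (\<integral>x. f x \<partial>(density (distr lborel borel (\<lambda>x. t + r *\<^sub>R x)) (\<lambda>_. ennreal (r ^ DIM('a)))))"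
    using assms(2) by (subst lborel_affine[of r t]) (simp_all add: ennreal_power)
  also have "\<dots> = (\<integral>x. (r ^ DIM('a)) *\<^sub>R f (t + r *\<^sub>R x) \<partial>lborel)"
    using assms(2) by (simp add: integral_density integral_distr)
  finally show ?thesis by simp
qed

lemma integrable_cball_indicator: "integrable lborel (\<lambda>x::'a::euclidean_space. c * indicat_real (cball a R) x)"
  by (intro integrable_mult_right integrable_real_indicator) (auto simp: emeasure_lborel_cball_finite[unfolded infinity_ennreal_def])

lemma norm_lipschitz_imp_continuous:
  fixes v :: "'a::real_normed_vector \<Rightarrow> 'b::real_normed_vector"
  assumes "\<And>x y. norm (v x - v y) \<le> L * norm (x - y)"
  shows "continuous_on UNIV v"
proof (rule lipschitz_on_continuous_on)
  \<comment> \<open>A Lipschitz constant in the sense of \<open>lipschitz_on\<close> must be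
    nonnegative, and the sign of L is not given.\<close>
  show "(max L 0)-lipschitz_on UNIV v"
    unfolding lipschitz_on_def dist_norm
    using order_trans[OF assms mult_right_mono[OF max.cobounded1[of L 0] norm_ge_zero]] by auto
qed

lemma integrable_bounded_zero_outside:
  fixes f :: "real^'n \<Rightarrow> 'b::{banach, second_countable_topology}"
  assumes [measurable]: "f \<in> borel_measurable borel"
    and "\<And>x. norm (f x) \<le> M" "\<And>x. norm x > R \<Longrightarrow> f x = 0"
  shows "integrable lborel f"
proof (rule Bochner_Integration.integrable_bound)
  show "integrable lborel (\<lambda>x. M * indicator (cball 0 R) x :: real)"
    by (rule integrable_cball_indicator)
  show "AE x in lborel. norm (f x) \<le> norm (M * indicator (cball 0 R) x :: real)"
    using assms(2,3) by (intro AE_I2) (auto simp: indicator_def intro: order_trans[OF _ abs_ge_self])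
qed (use assms in auto)

text \<open>Balls about the origin are enough, since every C1 test function vanishes outside one of
  them.\<close>

definition loc_int :: "(real^'n \<Rightarrow> 'b::euclidean_space) \<Rightarrow> bool" where
  "loc_int f \<longleftrightarrow> f \<in> borel_measurable borel \<and> (\<forall>R. set_integrable lborel (cball 0 R) f)"

lemma loc_int_measurable: "loc_int f \<Longrightarrow> f \<in> borel_measurable borel"
  by (simp add: loc_int_def)

lemma loc_int_integrable: "integrable lborel f \<Longrightarrow> loc_int f"
  unfolding loc_int_def using integrable_mult_indicator[of "cball 0 _" lborel f]
  by (auto simp: set_integrable_def dest: borel_measurable_integrable)

lemma loc_int_continuous:
  assumes "continuous_on UNIV f"
  shows "loc_int f"
  unfolding loc_int_def
  using assms borel_integrable_compact[of "cball 0 _" f]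
  by (auto intro: borel_measurable_continuous_onI continuous_on_subset simp: set_integrable_def)

lemma loc_int_bounded:
  assumes "f \<in> borel_measurable borel" "\<And>x. norm (f x) \<le> M"
  shows "loc_int f"
  unfolding loc_int_def set_integrable_def
proof (intro conjI allI integrable_bounded_zero_outside[where M=M])
  show "norm (indicat_real (cball 0 R) x *\<^sub>R f x) \<le> M" for R x
    using assms(2)[of x] norm_ge_zero[of "f x"] by (auto simp: indicator_def simp del: norm_ge_zero)
  show "(\<lambda>x. indicat_real (cball 0 R) x *\<^sub>R f x) \<in> borel_measurable borel" for R
    by (intro borel_measurable_scaleR borel_measurable_indicator assms(1)) auto
  show "indicat_real (cball 0 R) x *\<^sub>R f x = 0" if "norm x > R" for x R
    using that by simp
qed (use assms in auto)

lemma loc_int_prod: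
  fixes f :: "real^'n \<Rightarrow> 'b::euclidean_space"
  assumes "loc_int f" and [measurable]: "g \<in> borel_measurable borel"
    and bd: "\<And>x. norm (g x) \<le> M * norm (f x)" and z: "\<And>x. norm x > R \<Longrightarrow> g x = 0"
  shows "integrable lborel (g :: real^'n \<Rightarrow> 'c::euclidean_space)"
proof (rule Bochner_Integration.integrable_bound)
  show "integrable lborel (\<lambda>x. M *\<^sub>R (indicator (cball 0 R) x *\<^sub>R f x))"
    using assms(1) unfolding loc_int_def set_integrable_def by (intro integrable_scaleR_right) auto
  show "AE x in lborel. norm (g x) \<le> norm (M *\<^sub>R (indicator (cball 0 R) x *\<^sub>R f x))"
  proof (intro AE_I2)
    fix x
    have "norm (g x) \<le> \<bar>M\<bar> * norm (f x)"
      using bd[of x] by (meson abs_ge_self mult_right_mono norm_ge_zero order_trans)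
    then show "norm (g x) \<le> norm (M *\<^sub>R (indicator (cball 0 R) x *\<^sub>R f x))"
      using z[of x] by (auto simp: indicator_def)
  qed
qed auto

lemma outer_measurable[measurable]:
  assumes [measurable]: "f \<in> borel_measurable M" "g \<in> borel_measurable M"
  shows "(\<lambda>x. outer (f x) (g x)) \<in> borel_measurable M"
proof -
  have "continuous_on UNIV (\<lambda>p. outer (fst p) (snd p))"
    by (rule bounded_bilinear.continuous_on[OF bounded_bilinear_outer continuous_on_fst[OF continuous_on_id]
          continuous_on_snd[OF continuous_on_id]])
  then show ?thesis
    by (rule borel_measurable_continuous_Pair[OF assms])
qed

lemma C1_test_integrable:
  assumes "C1_test \<phi> D" "loc_int v"
  shows "integrable lborel (\<lambda>x. \<phi> x *\<^sub>R (v x :: 'b::euclidean_space))"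
proof -
  obtain M R where MR: "M \<ge> 0" "\<And>x. \<bar>\<phi> x\<bar> \<le> M" "\<And>x. norm (D x) \<le> M"
    "\<And>x. norm x > R \<Longrightarrow> \<phi> x = 0" "\<And>x. norm x > R \<Longrightarrow> D x = 0"
    using C1_test_bounded[OF assms(1)] by blast
  have [measurable]: "\<phi> \<in> borel_measurable borel" "D \<in> borel_measurable borel" "v \<in> borel_measurable borel"
    using C1_test_measurable[OF assms(1)] assms(2) by (auto simp: loc_int_def)
  show ?thesis
    using assms(2)
  proof (rule loc_int_prod[where M=M and R=R])
    show "norm (\<phi> x *\<^sub>R v x) \<le> M * norm (v x)" for x
      using mult_right_mono[OF MR(2)[of x] norm_ge_zero[of "v x"]] by simp
    show "\<phi> x *\<^sub>R v x = 0" if "norm x > R" for x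
      using MR(4)[OF that] by simp
  qed measurable
qed

lemma C1_test_integrable_outer:
  assumes "C1_test \<phi> D" "loc_int v"
  shows "integrable lborel (\<lambda>x. outer (v x) (D x))"
proof -
  obtain M R where MR: "M \<ge> 0" "\<And>x. \<bar>\<phi> x\<bar> \<le> M" "\<And>x. norm (D x) \<le> M"
    "\<And>x. norm x > R \<Longrightarrow> \<phi> x = 0" "\<And>x. norm x > R \<Longrightarrow> D x = 0"
    using C1_test_bounded[OF assms(1)] by blast
  have [measurable]: "\<phi> \<in> borel_measurable borel" "D \<in> borel_measurable borel" "v \<in> borel_measurable borel"
    using C1_test_measurable[OF assms(1)] assms(2) by (auto simp: loc_int_def)
  show ?thesis
    using assms(2)
  proof (rule loc_int_prod[where M=M and R=R])
    show "norm (outer (v x) (D x)) \<le> M * norm (v x)" for x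
      using mult_right_mono[OF MR(3)[of x] norm_ge_zero[of "v x"]] by (simp add: norm_outer mult.commute)
    show "outer (v x) (D x) = 0" if "norm x > R" for x
      using MR(5)[OF that] by (simp add: bounded_bilinear.zero_right[OF bounded_bilinear_outer])
  qed measurable
qed

section \<open>Sums, rescalings and series of weakly differentiable maps\<close>

lemma weak_der_add:
  assumes "weak_der v V" "weak_der w W" "loc_int v" "loc_int w" "loc_int V" "loc_int W"
  shows "weak_der (\<lambda>x. v x + w x) (\<lambda>x. V x + W x)"
  unfolding weak_der_def
proof (intro allI impI)
  fix \<phi> D assume t: "C1_test \<phi> (D :: real^'a \<Rightarrow> real^'a)"
  show "(\<integral>x. outer (v x + w x) (D x) \<partial>lborel) = - (\<integral>x. \<phi> x *\<^sub>R (V x + W x) \<partial>lborel)"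
    using assms t
    by (simp add: bounded_bilinear.add_left[OF bounded_bilinear_outer] scaleR_add_right
        C1_test_integrable[OF t] C1_test_integrable_outer[OF t] weak_der_def)
qed

lemma weak_der_scaleR:
  assumes "weak_der v V"
  shows "weak_der (\<lambda>x. c *\<^sub>R v x) (\<lambda>x. c *\<^sub>R V x)"
  unfolding weak_der_def
proof (intro allI impI)
  fix \<phi> D assume t: "C1_test \<phi> (D :: real^'a \<Rightarrow> real^'a)"
  have "(\<lambda>x. \<phi> x *\<^sub>R c *\<^sub>R V x) = (\<lambda>x. c *\<^sub>R \<phi> x *\<^sub>R V x)"
    by (simp add: mult.commute)
  then have "(\<integral>x. \<phi> x *\<^sub>R c *\<^sub>R V x \<partial>lborel) = c *\<^sub>R (\<integral>x. \<phi> x *\<^sub>R V x \<partial>lborel)"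
    by (simp only: integral_scaleR_right)
  then show "(\<integral>x. outer (c *\<^sub>R v x) (D x) \<partial>lborel) = - (\<integral>x. \<phi> x *\<^sub>R c *\<^sub>R V x \<partial>lborel)"
    using assms t
    by (simp add: bounded_bilinear.scaleR_left[OF bounded_bilinear_outer] weak_der_def)
qed

text \<open>The outer factor r cancels the 1/r of the chain rule, so gradients are merely composed
  with the similarity. The affine map is moved onto the test function, which stays in the C1
  class.\<close>

lemma weak_der_rescale:
  fixes v :: "real^'n \<Rightarrow> real^'n"
  assumes "weak_der v V" "r > 0" and [measurable]: "v \<in> borel_measurable borel" "V \<in> borel_measurable borel"
  shows "weak_der (\<lambda>x. r *\<^sub>R v ((x - a) /\<^sub>R r)) (\<lambda>x. V ((x - a) /\<^sub>R r))"
  unfolding weak_der_def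
proof (intro allI impI)
  fix \<phi> D assume t: "C1_test \<phi> (D :: real^'n \<Rightarrow> real^'n)"
  have [measurable]: "\<phi> \<in> borel_measurable borel" "D \<in> borel_measurable borel"
    using C1_test_measurable[OF t] by auto
  have "(\<integral>x. outer (r *\<^sub>R v ((x - a) /\<^sub>R r)) (D x) \<partial>lborel)
      = r ^ CARD('n) *\<^sub>R (\<integral>x. outer (v x) (r *\<^sub>R D (a + r *\<^sub>R x)) \<partial>lborel)"
    using \<open>r > 0\<close>
    by (subst lborel_integral_affine[of _ r a])
       (auto simp: bounded_bilinear.scaleR_left[OF bounded_bilinear_outer] bounded_bilinear.scaleR_right[OF bounded_bilinear_outer])
  also have "\<dots> = r ^ CARD('n) *\<^sub>R (- (\<integral>x. \<phi> (a + r *\<^sub>R x) *\<^sub>R V x \<partial>lborel))"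
    using assms(1) C1_test_affine[OF t \<open>r > 0\<close>, of a] by (simp add: weak_der_def)
  also have "\<dots> = - (\<integral>x. \<phi> x *\<^sub>R V ((x - a) /\<^sub>R r) \<partial>lborel)"
    using \<open>r > 0\<close> by (subst lborel_integral_affine[of "\<lambda>x. \<phi> x *\<^sub>R V ((x - a) /\<^sub>R r)" r a]) auto
  finally show "(\<integral>x. outer (r *\<^sub>R v ((x - a) /\<^sub>R r)) (D x) \<partial>lborel) = - (\<integral>x. \<phi> x *\<^sub>R V ((x - a) /\<^sub>R r) \<partial>lborel)" .
qed

text \<open>By monotone convergence the sum of the norms has a finite integral, hence is finite
  almost everywhere.\<close>

lemma AE_summable_norm:
  fixes f :: "nat \<Rightarrow> 'a \<Rightarrow> 'b::{banach, second_countable_topology}"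
  assumes "\<And>k. integrable M (f k)" "summable (\<lambda>k. \<integral>x. norm (f k x) \<partial>M)"
  shows "AE x in M. summable (\<lambda>k. norm (f k x))"
proof -
  have [measurable]: "f k \<in> borel_measurable M" for k
    using assms(1) by auto
  have "(\<integral>\<^sup>+x. (\<Sum>k. ennreal (norm (f k x))) \<partial>M) = (\<Sum>k. \<integral>\<^sup>+x. norm (f k x) \<partial>M)"
    by (rule nn_integral_suminf) auto
  also have "\<dots> = (\<Sum>k. ennreal (\<integral>x. norm (f k x) \<partial>M))"
    using assms(1) by (intro suminf_cong nn_integral_eq_integral) auto
  also have "\<dots> < \<infinity>"
    using assms(2) by (simp add: ennreal_suminf_neq_top less_top)
  finally have "AE x in M. (\<Sum>k. ennreal (norm (f k x))) \<noteq> \<infinity>"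
    by (intro nn_integral_noteq_infinite) auto
  then show ?thesis
    by eventually_elim (auto intro!: summable_suminf_not_top)
qed

text \<open>A test function and its gradient are bounded, so absolute L1 summability of the maps and
  of the gradients survives the multiplication, and sum and integral can be exchanged on both
  sides.\<close>

lemma weak_der_suminf:
  assumes wd: "\<And>k. weak_der (v k) (V k)"
    and iv: "\<And>k. integrable lborel (v k)" and iV: "\<And>k. integrable lborel (V k)"
    and sv: "summable (\<lambda>k. \<integral>x. norm (v k x) \<partial>lborel)"
    and sV: "summable (\<lambda>k. \<integral>x. norm (V k x) \<partial>lborel)"
  shows "weak_der (\<lambda>x. \<Sum>k. v k x) (\<lambda>x. \<Sum>k. V k x)"
  unfolding weak_der_def
proof (intro allI impI)
  fix \<phi> D assume t: "C1_test \<phi> (D :: real^'a \<Rightarrow> real^'a)"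
  obtain M where M: "M \<ge> 0" "\<And>x. \<bar>\<phi> x\<bar> \<le> M" "\<And>x. norm (D x) \<le> M"
    using C1_test_bounded[OF t] by metis
  have [measurable]: "\<phi> \<in> borel_measurable borel" "D \<in> borel_measurable borel"
    using C1_test_measurable[OF t] by auto
  have [measurable]: "v k \<in> borel_measurable borel" "V k \<in> borel_measurable borel" for k
    using iv[of k] iV[of k] by auto
  have io: "integrable lborel (\<lambda>x. outer (v k x) (D x))" for k
    by (intro C1_test_integrable_outer[OF t] loc_int_integrable iv)
  have ip: "integrable lborel (\<lambda>x. \<phi> x *\<^sub>R V k x)" for k
    by (intro C1_test_integrable[OF t] loc_int_integrable iV)
  have so: "summable (\<lambda>k. \<integral>x. norm (outer (v k x) (D x)) \<partial>lborel)"
  proof (rule summable_comparison_test', rule summable_mult[OF sv, of M])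
    fix k
    have "(\<integral>x. norm (outer (v k x) (D x)) \<partial>lborel) \<le> (\<integral>x. M * norm (v k x) \<partial>lborel)"
      using io iv M(3) by (intro integral_mono integrable_norm integrable_mult_right)
        (auto simp: norm_outer mult.commute[of M] intro!: mult_left_mono)
    then show "norm (\<integral>x. norm (outer (v k x) (D x)) \<partial>lborel) \<le> M * (\<integral>x. norm (v k x) \<partial>lborel)"
      by simp
  qed
  have sp: "summable (\<lambda>k. \<integral>x. norm (\<phi> x *\<^sub>R V k x) \<partial>lborel)"
  proof (rule summable_comparison_test', rule summable_mult[OF sV, of M])
    fix k
    have "(\<integral>x. norm (\<phi> x *\<^sub>R V k x) \<partial>lborel) \<le> (\<integral>x. M * norm (V k x) \<partial>lborel)"
      using ip iV M(2) by (intro integral_mono integrable_norm integrable_mult_right) (auto intro!: mult_right_mono)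
    then show "norm (\<integral>x. norm (\<phi> x *\<^sub>R V k x) \<partial>lborel) \<le> M * (\<integral>x. norm (V k x) \<partial>lborel)"
      by simp
  qed
  \<comment> \<open>The series is only known to converge almost everywhere, so the bilinear map
    passes through it only there.\<close>
  have "(\<integral>x. outer (\<Sum>k. v k x) (D x) \<partial>lborel) = (\<integral>x. (\<Sum>k. outer (v k x) (D x)) \<partial>lborel)"
  proof (rule integral_cong_AE)
    show "AE x in lborel. outer (\<Sum>k. v k x) (D x) = (\<Sum>k. outer (v k x) (D x))"
      using AE_summable_norm[OF iv sv]
    proof eventually_elim
      case (elim x)
      show ?case
        by (rule bounded_linear.suminf[OF bounded_bilinear.bounded_linear_left[OF bounded_bilinear_outer]])
           (rule summable_norm_cancel[OF elim])
    qed
  qed measurable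
  also have "\<dots> = (\<Sum>k. \<integral>x. outer (v k x) (D x) \<partial>lborel)"
    by (rule integral_suminf[OF io AE_summable_norm[OF io so] so])
  also have "\<dots> = (\<Sum>k. - (\<integral>x. \<phi> x *\<^sub>R V k x \<partial>lborel))"
    using wd t by (simp add: weak_der_def)
  also have "\<dots> = - (\<Sum>k. \<integral>x. \<phi> x *\<^sub>R V k x \<partial>lborel)"
    by (rule suminf_minus[OF summable_integral[OF ip AE_summable_norm[OF ip sp] sp]])
  also have "(\<Sum>k. \<integral>x. \<phi> x *\<^sub>R V k x \<partial>lborel) = (\<integral>x. (\<Sum>k. \<phi> x *\<^sub>R V k x) \<partial>lborel)"
    by (rule integral_suminf[OF ip AE_summable_norm[OF ip sp] sp, symmetric])
  also have "\<dots> = (\<integral>x. \<phi> x *\<^sub>R (\<Sum>k. V k x) \<partial>lborel)"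
  proof (rule integral_cong_AE)
    show "AE x in lborel. (\<Sum>k. \<phi> x *\<^sub>R V k x) = \<phi> x *\<^sub>R (\<Sum>k. V k x)"
      using AE_summable_norm[OF iV sV]
    proof eventually_elim
      case (elim x)
      show ?case
        by (rule suminf_scaleR_right[symmetric]) (rule summable_norm_cancel[OF elim])
    qed
  qed measurable
  finally show "(\<integral>x. outer (\<Sum>k. v k x) (D x) \<partial>lborel) = - (\<integral>x. \<phi> x *\<^sub>R (\<Sum>k. V k x) \<partial>lborel)" .
qed

text \<open>The integral of a difference quotient vanishes by translation invariance; pass to the limit by dominated
  convergence. This replaces Fubini's theorem.\<close>

lemma integral_directional_derivative_zero:
  fixes w w' :: "real^'n \<Rightarrow> real"
  assumes lip: "\<And>x y. \<bar>w x - w y\<bar> \<le> L * norm (x - y)"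
    and z: "\<And>x. norm x > R \<Longrightarrow> w x = 0"
    and der: "AE x in lborel. ((\<lambda>t. w (x + t *\<^sub>R e)) has_real_derivative w' x) (at 0)"
    and [measurable]: "w' \<in> borel_measurable borel" and e: "norm e = 1"
  shows "(\<integral>x. w' x \<partial>lborel) = 0"
proof -
  have "continuous_on UNIV w"
    using lip by (intro norm_lipschitz_imp_continuous[of _ L]) auto
  then have wm[measurable]: "w \<in> borel_measurable borel"
    by (rule borel_measurable_continuous_onI)
  obtain M where "\<And>x. norm (w x) \<le> M"
    using continuous_zero_outside_bounded[OF \<open>continuous_on UNIV w\<close> z] by blast
  then have iw: "integrable lborel w"
    using z by (intro integrable_bounded_zero_outside) auto
  define t where "t m = inverse (real (Suc m))" for m
  have t: "t m > 0" "t m \<le> 1" for m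
    by (auto simp: t_def field_simps)
  define s where "s m x = (w (x + t m *\<^sub>R e) - w x) / t m" for m x
  have s0: "(\<integral>x. s m x \<partial>lborel) = 0" for m
  proof -
    have i: "integrable lborel (\<lambda>x. w (x + t m *\<^sub>R e))"
      using iw integrable_distr_eq[of "(+) (t m *\<^sub>R e)" lborel borel w]
      by (simp add: lborel_distr_plus add.commute)
    have "(\<integral>x. w (x + t m *\<^sub>R e) \<partial>lborel) = (\<integral>x. w x \<partial>lborel)"
      using integral_distr[of "(+) (t m *\<^sub>R e)" lborel borel w]
      by (simp add: lborel_distr_plus add.commute)
    then show ?thesis
      unfolding s_def using i iw by simp
  qed
  have "(\<lambda>m. \<integral>x. s m x \<partial>lborel) \<longlonglongrightarrow> (\<integral>x. w' x \<partial>lborel)"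
  proof (rule integral_dominated_convergence)
    \<comment> \<open>The quotients are bounded by the Lipschitz constant; the radius of the support
      grows by 1 because the steps \<open>t m\<close> are at most 1.\<close>
    show "integrable lborel (\<lambda>x. L * indicator (cball 0 (R + 1)) x :: real)"
      by (rule integrable_cball_indicator)
    show "AE x in lborel. (\<lambda>m. s m x) \<longlonglongrightarrow> w' x"
      using der
    proof eventually_elim
      case (elim x)
      have "filterlim t (at 0) sequentially"
        unfolding t_def using LIMSEQ_inverse_real_of_nat
        by (intro filterlim_atI) auto
      from filterlim_compose[OF elim[unfolded DERIV_def] this] show ?case
        by (simp add: s_def)
    qed
    show "AE x in lborel. norm (s m x) \<le> L * indicator (cball 0 (R + 1)) x" for m
    proof (intro AE_I2)
      fix x
      have "\<bar>w (x + t m *\<^sub>R e) - w x\<bar> \<le> L * t m"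
        using lip[of "x + t m *\<^sub>R e" x] e t[of m] by simp
      then have 1: "norm (s m x) \<le> L"
        using t[of m] by (simp add: s_def field_simps)
      have "s m x = 0" if "norm x > R + 1"
      proof -
        have "norm x \<le> norm (x + t m *\<^sub>R e) + norm (t m *\<^sub>R e)"
          using norm_triangle_ineq4[of "x + t m *\<^sub>R e" "t m *\<^sub>R e"] by simp
        then have "norm (x + t m *\<^sub>R e) > R" using that t[of m] e by simp
        then show ?thesis using z that by (simp add: s_def)
      qed
      then show "norm (s m x) \<le> L * indicator (cball 0 (R + 1)) x"
        using 1 by (cases "norm x > R + 1") auto
    qed
  qed (auto simp: s_def)
  then show ?thesis using s0 by (simp add: LIMSEQ_const_iff)
qed

text \<open>The product of a test function and a component of v is Lipschitz with bounded support,
  so the integral of its directional derivative is zero; by the product rule this is the entry of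
  the claimed identity. Almost everywhere differentiability is a hypothesis, so Rademacher's theorem
  does not enter.\<close>

lemma weak_der_lipschitz:
  fixes v :: "real^'n \<Rightarrow> real^'n"
  assumes lip: "\<And>x y. norm (v x - v y) \<le> L * norm (x - y)"
    and der: "AE x in lborel. (v has_derivative (\<lambda>h. V x *v h)) (at x)"
    and [measurable]: "V \<in> borel_measurable borel" and bV: "\<And>x. norm (V x) \<le> B"
  shows "weak_der v V"
  unfolding weak_der_def
proof (intro allI impI)
  fix \<phi> D assume t: "C1_test \<phi> (D :: real^'n \<Rightarrow> real^'n)"
  obtain M R where MR: "M \<ge> 0" "\<And>x. \<bar>\<phi> x\<bar> \<le> M" "\<And>x. norm (D x) \<le> M"
    "\<And>x. norm x > R \<Longrightarrow> \<phi> x = 0" "\<And>x. norm x > R \<Longrightarrow> D x = 0"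
    using C1_test_bounded[OF t] by metis
  have [measurable]: "\<phi> \<in> borel_measurable borel" "D \<in> borel_measurable borel"
    using C1_test_measurable[OF t] by auto
  have cv: "continuous_on UNIV v"
    using lip by (rule norm_lipschitz_imp_continuous)
  then have [measurable]: "v \<in> borel_measurable borel"
    by (rule borel_measurable_continuous_onI)
  obtain N where N: "N \<ge> 0" "\<And>x. norm x \<le> R \<Longrightarrow> norm (v x) \<le> N"
  proof -
    have "compact (v ` cball 0 R)"
      using cv by (intro compact_continuous_image) (auto intro: continuous_on_subset)
    then obtain N where "\<And>x. x \<in> cball 0 R \<Longrightarrow> norm (v x) \<le> N"
      using compact_imp_bounded bounded_iff by (metis image_eqI)
    then show ?thesis using that[of "max N 0"] by (auto simp: le_max_iff_disj)
  qed
  have io: "integrable lborel (\<lambda>x. outer (v x) (D x))"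
    by (intro C1_test_integrable_outer[OF t] loc_int_continuous cv)
  have ip: "integrable lborel (\<lambda>x. \<phi> x *\<^sub>R V x)"
    by (intro C1_test_integrable[OF t] loc_int_bounded[OF _ bV]) auto
  have "(\<integral>x. outer (v x) (D x) \<partial>lborel) $ i $ j = - (\<integral>x. \<phi> x *\<^sub>R V x \<partial>lborel) $ i $ j" for i j
  proof -
    have bl: "bounded_linear (\<lambda>A::real^'n^'n. A $ i $ j)"
      using bounded_linear_compose[OF bounded_linear_vec_nth bounded_linear_vec_nth] .
    let ?w = "\<lambda>x. \<phi> x * v x $ i"
    let ?w' = "\<lambda>x. outer (v x) (D x) $ i $ j + (\<phi> x *\<^sub>R V x) $ i $ j"
    have "(\<integral>x. ?w' x \<partial>lborel) = 0"
    proof (rule integral_directional_derivative_zero)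
      \<comment> \<open>The bound N for v is available only where the test function may live.
        Writing the difference so that v is evaluated alone only at y asks for just one point in
        that ball.\<close>
      have half: "\<bar>?w x - ?w y\<bar> \<le> (M * L + M * N) * norm (x - y)" if y: "norm y \<le> R" for x y
      proof -
        have "?w x - ?w y = \<phi> x * (v x - v y) $ i + (\<phi> x - \<phi> y) * v y $ i"
          by (simp add: algebra_simps)
        also have "\<bar>\<dots>\<bar> \<le> \<bar>\<phi> x\<bar> * \<bar>(v x - v y) $ i\<bar> + \<bar>\<phi> x - \<phi> y\<bar> * \<bar>v y $ i\<bar>"
          by (rule order_trans[OF abs_triangle_ineq]) (simp add: abs_mult)
        also have "\<dots> \<le> M * (L * norm (x - y)) + (M * norm (x - y)) * N"
          using MR N(1) N(2)[OF y] lip[of x y] C1_test_lipschitz[OF t MR(3)]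
            component_le_norm_cart[of "v x - v y" i] component_le_norm_cart[of "v y" i]
          by (intro add_mono mult_mono) (auto simp del: vector_minus_component)
        finally show ?thesis by (simp add: algebra_simps)
      qed
      show "\<bar>?w x - ?w y\<bar> \<le> (M * L + M * N) * norm (x - y)" for x y
      proof (cases "norm y \<le> R \<or> norm x \<le> R")
        case True
        then show ?thesis using half[of y x] half[of x y] by (auto simp: norm_minus_commute abs_minus_commute)
      next
        case False
        \<comment> \<open>With both points outside the support the left side is 0 and the bound
          reduces to L \<ge> 0, which the Lipschitz hypothesis yields at a unit vector.\<close>
        have "0 \<le> L * norm (axis undefined 1 - 0 :: real^'n)"
          using lip order_trans[OF norm_ge_zero] by blast
        then have "L \<ge> 0" by simp
        with False show ?thesis using MR N by (simp add: not_le)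
      qed
      show "?w x = 0" if "norm x > R" for x using MR that by simp
      show "?w' \<in> borel_measurable borel"
        using borel_measurable_integrable[OF integrable_bounded_linear[OF bl io]]
          borel_measurable_integrable[OF integrable_bounded_linear[OF bl ip]]
        by simp
      show "norm (axis j 1 :: real^'n) = 1" by simp
      show "AE x in lborel. ((\<lambda>t. ?w (x + t *\<^sub>R axis j 1)) has_real_derivative ?w' x) (at 0)"
        using der
      proof eventually_elim
        case (elim x)
        have l: "((\<lambda>t. x + t *\<^sub>R axis j 1) has_derivative (\<lambda>t. t *\<^sub>R axis j 1)) (at 0)"
          by (auto intro!: derivative_eq_intros)
        have "(\<phi> has_derivative (\<lambda>h. D x \<bullet> h)) (at (x + 0 *\<^sub>R axis j 1))"
          using t by (simp add: C1_test_def)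
        from has_derivative_compose[OF l this]
        have 1: "((\<lambda>t. \<phi> (x + t *\<^sub>R axis j 1)) has_derivative (\<lambda>t. D x \<bullet> (t *\<^sub>R axis j 1))) (at 0)" .
        have "(v has_derivative (\<lambda>h. V x *v h)) (at (x + 0 *\<^sub>R axis j 1))"
          using elim by simp
        from has_derivative_compose[OF l this]
        have "((\<lambda>t. v (x + t *\<^sub>R axis j 1)) has_derivative (\<lambda>t. V x *v (t *\<^sub>R axis j 1))) (at 0)" .
        then have 2: "((\<lambda>t. v (x + t *\<^sub>R axis j 1) $ i) has_derivative (\<lambda>t. (V x *v (t *\<^sub>R axis j 1)) $ i)) (at 0)"
          by (rule bounded_linear.has_derivative[OF bounded_linear_vec_nth])
        show ?case
          unfolding has_field_derivative_def
          by (rule has_derivative_eq_rhs[OF has_derivative_mult[OF 1 2]])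
             (auto simp: outer_nth inner_axis matrix_vector_mult_scaleR matrix_vector_mult_basis column_def algebra_simps)
      qed
    qed
    moreover have "(\<integral>x. ?w' x \<partial>lborel) = (\<integral>x. outer (v x) (D x) \<partial>lborel) $ i $ j + (\<integral>x. \<phi> x *\<^sub>R V x \<partial>lborel) $ i $ j"
      using integral_bounded_linear[OF bl io] integral_bounded_linear[OF bl ip]
        integrable_bounded_linear[OF bl io] integrable_bounded_linear[OF bl ip]
      by simp
    ultimately show ?thesis by simp
  qed
  then show "(\<integral>x. outer (v x) (D x) \<partial>lborel) = - (\<integral>x. \<phi> x *\<^sub>R V x \<partial>lborel)"
    by (simp add: vec_eq_iff)
qed

section \<open>Packings by balls\<close>

text \<open>Radii are allowed to vanish, so that a finite packing is also a sequence; the ball is then empty.\<close>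

locale ball_packing =
  fixes a :: "nat \<Rightarrow> real^'n" and r :: "nat \<Rightarrow> real" and W :: "(real^'n) set" and \<delta> :: real
  assumes r_nonneg: "0 \<le> r i" and r_le: "r i \<le> \<delta>"
    and disj: "disjoint_family (\<lambda>i. ball (a i) (r i))"
    and cball_sub: "0 < r i \<Longrightarrow> cball (a i) (r i) \<subseteq> W"
    and cover: "negligible (W - (\<Union>i. ball (a i) (r i)))"
    and open_W: "open W" and bounded_W: "bounded W"

text \<open>This is Vitali's covering theorem for the fine family of balls of radius at most
  \<delta> whose closures lie in W, followed by an enumeration.\<close>

lemma ball_packing_exists:
  fixes W :: "(real^'n) set"
  assumes "open W" "bounded W" "\<delta> > 0"
  shows "\<exists>a r. ball_packing a r W \<delta>"
proof -
  define K where "K = {(a::real^'n, r::real). 0 < r \<and> r \<le> \<delta> \<and> cball a r \<subseteq> W}"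
  obtain C where C: "countable C" "C \<subseteq> K"
     "pairwise (\<lambda>i j. disjnt (ball (fst i) (snd i)) (ball (fst j) (snd j))) C"
     "negligible (W - (\<Union>i \<in> C. ball (fst i) (snd i)))"
  proof (rule Vitali_covering_theorem_balls[of W K fst snd])
    fix x d assume x: "x \<in> W" and d: "0 < (d::real)"
    obtain e where e: "e > 0" "cball x e \<subseteq> W"
      using x assms(1) open_contains_cball by blast
    \<comment> \<open>Here d/2 gives the strict inequality required of a fine cover, e keeps the
      closed ball inside W, and \<delta> enforces the cap.\<close>
    let ?r = "min (d/2) (min e \<delta>)"
    have "(x, ?r) \<in> K"
      using e d assms(3) subset_cball[of ?r e x] unfolding K_def by auto
    then show "\<exists>i. i \<in> K \<and> x \<in> ball (fst i) (snd i) \<and> snd i < d"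
      using d e assms(3) by (intro exI[of _ "(x, ?r)"]) auto
  qed
  define I where "I = to_nat_on C ` C"
  define a where "a i = fst (from_nat_into C i)" for i
  \<comment> \<open>For an index not coming from C, \<open>from_nat_into\<close> returns some
    element of C and would repeat a ball; radius 0 makes that repetition empty.\<close>
  define r where "r i = (if i \<in> I then snd (from_nat_into C i) else 0)" for i
  have inC: "from_nat_into C i \<in> C" if "i \<in> I" for i
    using that C(1) by (auto simp: I_def)
  have "ball_packing a r W \<delta>"
  proof
    have inK: "0 < snd (from_nat_into C i) \<and> snd (from_nat_into C i) \<le> \<delta> \<and>
        cball (fst (from_nat_into C i)) (snd (from_nat_into C i)) \<subseteq> W" if "i \<in> I" for i
      using inC[OF that] C(2) unfolding K_def case_prod_unfold by blast
    show "0 \<le> r i" "r i \<le> \<delta>" for i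
      using inK[of i] assms(3) by (auto simp: r_def)
    show "0 < r i \<Longrightarrow> cball (a i) (r i) \<subseteq> W" for i
      using inK[of i] by (cases "i \<in> I") (simp_all add: r_def a_def)
    show "disjoint_family (\<lambda>i. ball (a i) (r i))"
      unfolding disjoint_family_on_def
    proof (intro ballI impI)
      fix i j :: nat assume "i \<noteq> j"
      show "ball (a i) (r i) \<inter> ball (a j) (r j) = {}"
      proof (cases "i \<in> I \<and> j \<in> I")
        case True
        then obtain p q where pq: "p \<in> C" "q \<in> C" "i = to_nat_on C p" "j = to_nat_on C q"
          by (auto simp: I_def)
        then have "p \<noteq> q" using \<open>i \<noteq> j\<close> by auto
        then show ?thesis
          using C(3) pq True C(1) by (auto simp: pairwise_def disjnt_def a_def r_def)
      next
        case False
        then show ?thesis by (auto simp: r_def)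
      qed
    qed
    have "(\<Union>i\<in>C. ball (fst i) (snd i)) \<subseteq> (\<Union>i. ball (a i) (r i))"
    proof
      fix x assume "x \<in> (\<Union>i\<in>C. ball (fst i) (snd i))"
      then obtain p where p: "p \<in> C" "x \<in> ball (fst p) (snd p)" by blast
      then have "x \<in> ball (a (to_nat_on C p)) (r (to_nat_on C p))"
        using C(1) by (simp add: a_def r_def I_def)
      then show "x \<in> (\<Union>i. ball (a i) (r i))" by blast
    qed
    then show "negligible (W - (\<Union>i. ball (a i) (r i)))"
      using C(4) by (meson Diff_mono negligible_subset order_refl)
  qed (use assms in auto)
  then show ?thesis by blast
qed

lemma null_sets_lborel_negligible:
  "S \<in> sets borel \<Longrightarrow> negligible S \<Longrightarrow> S \<in> null_sets lborel"
  by (metis negligible_iff_null_sets null_sets_completion_iff sets_lborel)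

section \<open>Copying maps and gradients into the balls of a packing\<close>

context ball_packing
begin

definition \<U> where "\<U> = (\<Union>i. ball (a i) (r i))"

definition inv_chart where "inv_chart i x = (x - a i) /\<^sub>R r i"

text \<open>The transport of gradients, hence without a factor \<open>r i\<close>. The indicator
  also silences indices of radius 0, where \<open>inv_chart i\<close> is constantly 0.\<close>

definition pull :: "(real^'n \<Rightarrow> 'b::euclidean_space) \<Rightarrow> real^'n \<Rightarrow> 'b" where
  "pull V x = (\<Sum>i. indicator (ball (a i) (r i)) x *\<^sub>R V (inv_chart i x))"

text \<open>The transport of maps. It is meant for maps vanishing outside the unit ball, whose
  copies vanish outside their own balls without an indicator; at radius 0 the factor
  \<open>r i\<close> removes the term.\<close>

definition lift :: "(real^'n \<Rightarrow> 'b::euclidean_space) \<Rightarrow> real^'n \<Rightarrow> 'b" where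
  "lift v x = (\<Sum>i. r i *\<^sub>R v (inv_chart i x))"

text \<open>This number turns out to be the sum of the n-th powers of the radii, so it is the factor
  by which copying into the packing multiplies integrals over the unit ball.\<close>

definition mass where "mass = measure lborel W / measure lborel (ball (0::real^'n) 1)"

lemma measurable_inv_chart[measurable]: "inv_chart i \<in> borel_measurable borel"
  unfolding inv_chart_def by measurable

lemma sets_ball[measurable]: "ball (a i) (r i) \<in> sets borel" "ball (0::real^'n) 1 \<in> sets borel"
  by auto

lemma sets_\<U>[measurable]: "\<U> \<in> sets borel"
  unfolding \<U>_def by (intro borel_open open_UN) auto

lemma \<U>_subset: "\<U> \<subseteq> W"
proof
  fix x assume "x \<in> \<U>"
  then obtain i where "dist (a i) x < r i" by (auto simp: \<U>_def)
  then have "0 < r i" "x \<in> cball (a i) (r i)"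
    using le_less_trans[OF zero_le_dist] by auto
  then show "x \<in> W" using cball_sub by blast
qed

lemma null_uncovered: "W - \<U> \<in> null_sets lborel"
  using open_W cover by (intro null_sets_lborel_negligible) (auto simp: \<U>_def)

lemma ball_unique: "x \<in> ball (a i) (r i) \<Longrightarrow> x \<in> ball (a j) (r j) \<Longrightarrow> i = j"
  using disj unfolding disjoint_family_on_def by blast

lemma sums_single_ball:
  fixes f :: "nat \<Rightarrow> 'b::{comm_monoid_add, t2_space}"
  assumes "x \<in> ball (a i) (r i)" "\<And>j. x \<notin> ball (a j) (r j) \<Longrightarrow> f j = 0"
  shows "f sums f i"
proof -
  have "f j = 0" if "j \<noteq> i" for j
    using that assms(2)[of j] ball_unique[OF assms(1)] by blast
  then have "f = (\<lambda>j. if j = i then f j else 0)"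
    by auto
  then show ?thesis
    using sums_single[of i f] by simp
qed

lemma inv_chart_ball:
  assumes "r i > 0"
  shows "inv_chart i x \<in> ball 0 1 \<longleftrightarrow> x \<in> ball (a i) (r i)"
proof -
  have "norm (inv_chart i x) = norm (x - a i) / r i"
    using assms by (simp add: inv_chart_def divide_inverse_commute)
  then show ?thesis
    using assms by (simp add: dist_norm norm_minus_commute)
qed

lemma ball_imp_r_pos: "x \<in> ball (a i) (r i) \<Longrightarrow> r i > 0"
  using le_less_trans[OF zero_le_dist] by auto

lemma inv_chart_in_ball: "x \<in> ball (a i) (r i) \<Longrightarrow> inv_chart i x \<in> ball 0 1"
  using inv_chart_ball ball_imp_r_pos by blast

lemma pull_sums_in:
  fixes V :: "real^'n \<Rightarrow> 'b::euclidean_space"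
  assumes "x \<in> ball (a i) (r i)"
  shows "(\<lambda>j. indicator (ball (a j) (r j)) x *\<^sub>R V (inv_chart j x)) sums V (inv_chart i x)"
proof -
  have "(\<lambda>j. indicator (ball (a j) (r j)) x *\<^sub>R V (inv_chart j x)) sums
      (indicator (ball (a i) (r i)) x *\<^sub>R V (inv_chart i x))"
    by (rule sums_single_ball[OF assms]) simp
  then show ?thesis using assms by simp
qed

lemma pull_in: "x \<in> ball (a i) (r i) \<Longrightarrow> pull V x = V (inv_chart i x)"
  unfolding pull_def by (rule sums_unique[OF pull_sums_in, symmetric])

lemma pull_out: "x \<notin> \<U> \<Longrightarrow> pull V x = 0"
  unfolding pull_def \<U>_def by simp

lemma lift_term_zero:
  fixes v :: "real^'n \<Rightarrow> 'b::euclidean_space"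
  assumes "\<And>y. y \<notin> ball 0 1 \<Longrightarrow> v y = 0" "x \<notin> ball (a i) (r i)"
  shows "r i *\<^sub>R v (inv_chart i x) = 0"
proof (cases "r i > 0")
  case True
  then have "inv_chart i x \<notin> ball 0 1" using assms(2) inv_chart_ball by blast
  then have "v (inv_chart i x) = 0" by (rule assms(1))
  then show ?thesis by simp
next
  case False
  then show ?thesis using r_nonneg[of i] by simp
qed

lemma lift_in:
  fixes v :: "real^'n \<Rightarrow> 'b::euclidean_space"
  assumes "\<And>y. y \<notin> ball 0 1 \<Longrightarrow> v y = 0" "x \<in> ball (a i) (r i)"
  shows "lift v x = r i *\<^sub>R v (inv_chart i x)"
  unfolding lift_def
  by (rule sums_unique[symmetric], rule sums_single_ball[OF assms(2)]) (rule lift_term_zero[OF assms(1)])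

lemma lift_out:
  fixes v :: "real^'n \<Rightarrow> 'b::euclidean_space"
  assumes "\<And>y. y \<notin> ball 0 1 \<Longrightarrow> v y = 0" "x \<notin> \<U>"
  shows "lift v x = 0"
proof -
  have "r i *\<^sub>R v (inv_chart i x) = 0" for i
    by (rule lift_term_zero[OF assms(1)]) (use assms(2) in \<open>auto simp: \<U>_def\<close>)
  then show ?thesis by (simp only: lift_def suminf_zero)
qed

text \<open>Copying shrinks the sup norm by the largest radius although it leaves the size of
  gradients alone; this is where uniform convergence will come from.\<close>

lemma lift_norm_le:
  assumes "\<And>y. y \<notin> ball 0 1 \<Longrightarrow> v y = 0" "\<And>y. norm (v y) \<le> M"
  shows "norm (lift v x) \<le> \<delta> * M"
proof -
  have M: "0 \<le> M" using assms(2)[of 0] norm_ge_zero order_trans by blast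
  have d: "0 \<le> \<delta>" using r_nonneg[of 0] r_le[of 0] by simp
  show ?thesis
  proof (cases "x \<in> \<U>")
    case True
    then obtain i where i: "x \<in> ball (a i) (r i)" by (auto simp: \<U>_def)
    show ?thesis
      using lift_in[of v, OF assms(1) i] r_nonneg[of i] r_le[of i] assms(2) M d
      by (auto intro!: mult_mono)
  next
    case False
    then show ?thesis using lift_out[of v, OF assms(1)] M d by simp
  qed
qed

section \<open>Integrals over a packing\<close>

lemma pull_measurable[measurable]:
  assumes [measurable]: "V \<in> borel_measurable borel"
  shows "pull V \<in> borel_measurable borel"
  unfolding pull_def by measurable

lemma nn_integral_ball:
  assumes [measurable]: "g \<in> borel_measurable borel"
  shows "(\<integral>\<^sup>+x. indicator (ball (a i) (r i)) x * g (inv_chart i x) \<partial>lborel)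
    = ennreal (r i ^ CARD('n)) * (\<integral>\<^sup>+x. indicator (ball 0 1) x * g x \<partial>lborel)"
proof (cases "r i > 0")
  case True
  have "(\<integral>\<^sup>+x. indicator (ball (a i) (r i)) x * g (inv_chart i x) \<partial>lborel)
     = (\<integral>\<^sup>+x. indicator (ball 0 1) (inv_chart i x) * g (inv_chart i x) \<partial>lborel)"
    using inv_chart_ball[OF True] by (intro nn_integral_cong) (auto simp: indicator_def)
  also have "\<dots> = ennreal (r i ^ CARD('n)) * (\<integral>\<^sup>+x. indicator (ball 0 1) x * g x \<partial>lborel)"
    using True by (subst lborel_nn_integral_affine[of _ "r i" "a i"], measurable) (simp_all add: inv_chart_def)
  finally show ?thesis .
next
  case False
  then have "r i = 0" using r_nonneg[of i] by simp
  then show ?thesis by simp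
qed

text \<open>The balls are disjoint and each change of variables contributes
  \<open>r i ^ CARD('n)\<close>. F need only agree with the copies of g almost everywhere, because
  the limit gradient is known to be self-similar only off a null set.\<close>

lemma nn_integral_packing_suminf:
  assumes [measurable]: "g \<in> borel_measurable borel" "F \<in> borel_measurable borel"
    and F: "AE x in lborel. \<forall>i. x \<in> ball (a i) (r i) \<longrightarrow> F x = g (inv_chart i x)"
  shows "(\<integral>\<^sup>+x. indicator \<U> x * F x \<partial>lborel)
    = (\<Sum>i. ennreal (r i ^ CARD('n))) * (\<integral>\<^sup>+x. indicator (ball 0 1) x * g x \<partial>lborel)"
proof -
  have "(\<integral>\<^sup>+x. indicator \<U> x * F x \<partial>lborel)
    = (\<integral>\<^sup>+x. (\<Sum>i. indicator (ball (a i) (r i)) x * g (inv_chart i x)) \<partial>lborel)"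
  proof (rule nn_integral_cong_AE, use F in eventually_elim)
    case (elim x)
    show ?case
    proof (cases "x \<in> \<U>")
      case True
      then obtain i where i: "x \<in> ball (a i) (r i)" by (auto simp: \<U>_def)
      have "(\<lambda>j. indicator (ball (a j) (r j)) x * g (inv_chart j x)) sums (indicator (ball (a i) (r i)) x * g (inv_chart i x))"
        by (rule sums_single_ball[OF i]) simp
      then show ?thesis using elim i True by (simp add: sums_unique[symmetric])
    next
      case False
      then show ?thesis by (simp add: \<U>_def)
    qed
  qed
  also have "\<dots> = (\<Sum>i. \<integral>\<^sup>+x. indicator (ball (a i) (r i)) x * g (inv_chart i x) \<partial>lborel)"
    by (rule nn_integral_suminf) measurable
  also have "\<dots> = (\<Sum>i. ennreal (r i ^ CARD('n)) * (\<integral>\<^sup>+x. indicator (ball 0 1) x * g x \<partial>lborel))"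
    by (simp add: nn_integral_ball)
  finally show ?thesis by (simp add: ennreal_suminf_multc)
qed

text \<open>The case F = g = 1 of the integral formula, since the balls fill W up to a null
  set.\<close>

lemma emeasure_packing:
  "emeasure lborel W = (\<Sum>i. ennreal (r i ^ CARD('n))) * emeasure lborel (ball (0::real^'n) 1)"
proof -
  have "emeasure lborel \<U> = (\<integral>\<^sup>+x. indicator \<U> x * 1 \<partial>lborel)"
    by simp
  also have "\<dots> = (\<Sum>i. ennreal (r i ^ CARD('n))) * (\<integral>\<^sup>+x. indicator (ball (0::real^'n) 1) x * 1 \<partial>lborel)"
    by (rule nn_integral_packing_suminf) auto
  finally have 1: "emeasure lborel \<U> = (\<Sum>i. ennreal (r i ^ CARD('n))) * emeasure lborel (ball (0::real^'n) 1)"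
    by simp
  have "emeasure lborel (\<U> \<union> (W - \<U>)) = emeasure lborel \<U>"
    by (rule emeasure_Un_null_set[OF _ null_uncovered]) simp
  moreover have "\<U> \<union> (W - \<U>) = W" using \<U>_subset by blast
  ultimately show ?thesis using 1 by simp
qed

lemma packing_mass:
  "summable (\<lambda>i. r i ^ CARD('n))" "(\<Sum>i. ennreal (r i ^ CARD('n))) = ennreal mass" "mass \<ge> 0"
proof -
  let ?B = "ball (0::real^'n) 1"
  have fin: "emeasure lborel W < top"
    using emeasure_bounded_finite[OF bounded_W] by simp
  have pos: "measure lborel ?B > 0"
    using content_ball_pos[of 1 "0::real^'n"] by simp
  have eB: "emeasure lborel ?B = ennreal (measure lborel ?B)"
    using emeasure_lborel_ball_finite[of "0::real^'n" 1] by (intro emeasure_eq_ennreal_measure) simp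
  have "(\<Sum>i. ennreal (r i ^ CARD('n))) \<noteq> top"
  proof
    assume "(\<Sum>i. ennreal (r i ^ CARD('n))) = top"
    then have "emeasure lborel W = top * ennreal (measure lborel ?B)"
      using emeasure_packing eB by simp
    also have "\<dots> = top" using pos by (simp add: ennreal_top_mult)
    finally show False using fin by simp
  qed
  then show s: "summable (\<lambda>i. r i ^ CARD('n))"
    by (intro summable_suminf_not_top) (auto simp: r_nonneg)
  have e: "(\<Sum>i. ennreal (r i ^ CARD('n))) = ennreal (\<Sum>i. r i ^ CARD('n))"
    by (rule suminf_ennreal_eq[OF _ summable_sums[OF s]]) (simp add: r_nonneg)
  have n: "(\<Sum>i. r i ^ CARD('n)) \<ge> 0"
    by (rule suminf_nonneg[OF s]) (simp add: r_nonneg)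
  have "measure lborel W = (\<Sum>i. r i ^ CARD('n)) * measure lborel ?B"
    unfolding measure_def[of lborel W] emeasure_packing e eB using n by (simp add: enn2real_mult)
  then have m: "mass = (\<Sum>i. r i ^ CARD('n))"
    using pos by (simp add: mass_def)
  show "(\<Sum>i. ennreal (r i ^ CARD('n))) = ennreal mass"
    unfolding m by (rule e)
  show "mass \<ge> 0" unfolding m by (rule n)
qed

lemma nn_integral_packing:
  assumes "g \<in> borel_measurable borel" "F \<in> borel_measurable borel"
    and "AE x in lborel. \<forall>i. x \<in> ball (a i) (r i) \<longrightarrow> F x = g (inv_chart i x)"
  shows "(\<integral>\<^sup>+x. indicator \<U> x * F x \<partial>lborel)
    = ennreal mass * (\<integral>\<^sup>+x. indicator (ball 0 1) x * g x \<partial>lborel)"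
  using nn_integral_packing_suminf[OF assms] packing_mass(2) by simp

text \<open>Preimages of a null set under countably many similarities are null; exceptional sets can
  thus be carried into all balls at once.\<close>

lemma AE_inv_chart:
  assumes N: "N \<in> null_sets lborel"
  shows "AE x in lborel. \<forall>i. x \<in> ball (a i) (r i) \<longrightarrow> inv_chart i x \<notin> N"
proof -
  have [measurable]: "N \<in> sets borel" using N by auto
  have "AE x in lborel. x \<in> ball (a i) (r i) \<longrightarrow> inv_chart i x \<notin> N" for i
  proof -
    have "(\<integral>\<^sup>+x. indicator (ball (a i) (r i)) x * indicator N (inv_chart i x) \<partial>lborel)
      = ennreal (r i ^ CARD('n)) * (\<integral>\<^sup>+x. indicator (ball 0 1) x * indicator N x \<partial>lborel)"
      by (rule nn_integral_ball) measurable
    also have "(\<integral>\<^sup>+x. indicator (ball (0::real^'n) 1) x * indicator N x \<partial>lborel) = 0"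
      using AE_not_in[OF N] by (subst nn_integral_0_iff_AE) (auto elim!: eventually_mono)
    finally have "(\<integral>\<^sup>+x. indicator (ball (a i) (r i)) x * indicator N (inv_chart i x) \<partial>lborel) = 0"
      by simp
    then have "AE x in lborel. (indicator (ball (a i) (r i)) x * indicator N (inv_chart i x) :: ennreal) = 0"
      by (subst (asm) nn_integral_0_iff_AE) measurable
    then show ?thesis by eventually_elim (auto simp: indicator_def split: if_splits)
  qed
  then show ?thesis by (simp add: AE_all_countable)
qed

text \<open>At each point at most one term of the series is nonzero, so the tail is bounded by a
  tail radius times M. The radii tend to 0 because their n-th powers are summable, and the
  convergence is uniform.\<close>

lemma lift_continuous:
  assumes cont: "continuous_on UNIV v" and z: "\<And>y. y \<notin> ball 0 1 \<Longrightarrow> v y = 0" and M: "\<And>y. norm (v y) \<le> M"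
  shows "continuous_on UNIV (lift v)"
proof (rule uniform_limit_theorem)
  have r0: "eventually (\<lambda>i. r i < e) sequentially" if "e > 0" for e
  proof -
    have "eventually (\<lambda>i. r i ^ CARD('n) < e ^ CARD('n)) sequentially"
      by (rule order_tendstoD(2)[OF summable_LIMSEQ_zero[OF packing_mass(1)]]) (use that in simp)
    then show ?thesis
      by eventually_elim (use that in \<open>auto intro: power_less_imp_less_base\<close>)
  qed
  show "\<forall>\<^sub>F N in sequentially. continuous_on UNIV (\<lambda>x. \<Sum>i<N. r i *\<^sub>R v (inv_chart i x))"
    unfolding inv_chart_def
    by (intro always_eventually allI continuous_intros continuous_on_compose2[OF cont]) auto
  show "uniform_limit UNIV (\<lambda>N x. \<Sum>i<N. r i *\<^sub>R v (inv_chart i x)) (lift v) sequentially"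
  proof (rule uniform_limitI)
    fix e :: real assume "e > 0"
    have M0: "0 \<le> M" using M[of 0] norm_ge_zero order_trans by blast
    obtain N0 where N0: "\<And>i. i \<ge> N0 \<Longrightarrow> r i < e / (M + 1)"
      using r0[of "e / (M + 1)"] \<open>e > 0\<close> M0 by (auto simp: eventually_sequentially)
    have "dist (\<Sum>i<N. r i *\<^sub>R v (inv_chart i x)) (lift v x) < e" if "N \<ge> N0" for N x
    proof (cases "x \<in> \<U>")
      case True
      then obtain i where i: "x \<in> ball (a i) (r i)" by (auto simp: \<U>_def)
      have "(\<Sum>j<N. r j *\<^sub>R v (inv_chart j x)) = (\<Sum>j<N. if j = i then r i *\<^sub>R v (inv_chart i x) else 0)"
        using lift_term_zero[of v, OF z] ball_unique[OF i] by (intro sum.cong refl) (simp split: if_split del: mem_ball, blast)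
      also have "\<dots> = (if i < N then r i *\<^sub>R v (inv_chart i x) else 0)"
        by (simp add: sum.delta)
      finally have eq: "(\<Sum>j<N. r j *\<^sub>R v (inv_chart j x)) = (if i < N then r i *\<^sub>R v (inv_chart i x) else 0)" .
      show ?thesis
      proof (cases "i < N")
        case True
        then show ?thesis using eq lift_in[of v, OF z i] \<open>e > 0\<close> by simp
      next
        case False
        have "r i * norm (v (inv_chart i x)) \<le> r i * M"
          using r_nonneg M by (intro mult_left_mono) auto
        also have "\<dots> \<le> e / (M + 1) * M"
          using N0[of i] False that M0 by (intro mult_right_mono) auto
        also have "\<dots> < e" using \<open>e > 0\<close> M0 by (simp add: field_simps)
        finally show ?thesis using False eq lift_in[of v, OF z i] r_nonneg by simp
      qed
    next
      case False
      then have "(\<Sum>i<N. r i *\<^sub>R v (inv_chart i x)) = 0"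
        by (intro sum.neutral ballI lift_term_zero[of v, OF z]) (auto simp: \<U>_def)
      then show ?thesis using lift_out[of v, OF z False] \<open>e > 0\<close> by simp
    qed
    then show "\<forall>\<^sub>F N in sequentially. \<forall>x\<in>UNIV. dist (\<Sum>i<N. r i *\<^sub>R v (inv_chart i x)) (lift v x) < e"
      by (auto simp: eventually_sequentially)
  qed
qed auto

lemma integral_norm_pull:
  assumes iV: "integrable lborel V" and z: "\<And>y. y \<notin> ball 0 1 \<Longrightarrow> V y = 0"
  shows "integrable lborel (pull V)"
    and "(\<integral>x. norm (pull V x) \<partial>lborel) = mass * (\<integral>x. norm (V x) \<partial>lborel)"
proof -
  have [measurable]: "V \<in> borel_measurable borel" using iV by auto
  have "(\<integral>\<^sup>+x. norm (pull V x) \<partial>lborel) = (\<integral>\<^sup>+x. indicator \<U> x * ennreal (norm (pull V x)) \<partial>lborel)"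
    using pull_out by (intro nn_integral_cong) (auto simp: indicator_def)
  also have "\<dots> = ennreal mass * (\<integral>\<^sup>+x. indicator (ball 0 1) x * ennreal (norm (V x)) \<partial>lborel)"
    by (rule nn_integral_packing) (measurable, auto simp del: mem_ball simp: pull_in)
  also have "(\<integral>\<^sup>+x. indicator (ball 0 1) x * ennreal (norm (V x)) \<partial>lborel) = (\<integral>\<^sup>+x. norm (V x) \<partial>lborel)"
    using z by (intro nn_integral_cong) (auto simp: indicator_def)
  also have "\<dots> = ennreal (\<integral>x. norm (V x) \<partial>lborel)"
    using iV by (intro nn_integral_eq_integral) auto
  finally have eq: "(\<integral>\<^sup>+x. norm (pull V x) \<partial>lborel) = ennreal (mass * (\<integral>x. norm (V x) \<partial>lborel))"
    using packing_mass(3) by (simp add: ennreal_mult)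
  then show "integrable lborel (pull V)"
    by (intro integrableI_bounded) auto
  show "(\<integral>x. norm (pull V x) \<partial>lborel) = mass * (\<integral>x. norm (V x) \<partial>lborel)"
    by (subst integral_eq_nn_integral) (use eq packing_mass(3) in auto)
qed

text \<open>Each term is a rescaled copy of a map already weakly differentiable on the whole space
  and zero outside the unit ball, so no boundary terms appear. The L1 norms of the terms carry the
  factors r^n for gradients and r^(n+1) for maps, both summable.\<close>

lemma weak_der_lift:
  assumes wd: "weak_der v V" and iv: "integrable lborel v" and iV: "integrable lborel V"
    and zv: "\<And>y. y \<notin> ball 0 1 \<Longrightarrow> v y = 0" and zV: "\<And>y. y \<notin> ball 0 1 \<Longrightarrow> V y = 0"
  shows "weak_der (lift v) (pull V)"
proof -
  have [measurable]: "v \<in> borel_measurable borel" "V \<in> borel_measurable borel" using iv iV by auto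
  let ?v = "\<lambda>i x. r i *\<^sub>R v (inv_chart i x)"
  let ?V = "\<lambda>i x. indicator (ball (a i) (r i)) x *\<^sub>R V (inv_chart i x)"
  have nV: "(\<integral>\<^sup>+x. norm (?V i x) \<partial>lborel) = ennreal (r i ^ CARD('n) * (\<integral>x. norm (V x) \<partial>lborel))" for i
  proof -
    have "(\<integral>\<^sup>+x. norm (?V i x) \<partial>lborel) = (\<integral>\<^sup>+x. indicator (ball (a i) (r i)) x * ennreal (norm (V (inv_chart i x))) \<partial>lborel)"
      by (intro nn_integral_cong) (auto simp: indicator_def)
    also have "\<dots> = ennreal (r i ^ CARD('n)) * (\<integral>\<^sup>+x. indicator (ball 0 1) x * ennreal (norm (V x)) \<partial>lborel)"
      by (rule nn_integral_ball) measurable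
    also have "(\<integral>\<^sup>+x. indicator (ball 0 1) x * ennreal (norm (V x)) \<partial>lborel) = (\<integral>\<^sup>+x. norm (V x) \<partial>lborel)"
      using zV by (intro nn_integral_cong) (auto simp: indicator_def)
    also have "\<dots> = ennreal (\<integral>x. norm (V x) \<partial>lborel)"
      using iV by (intro nn_integral_eq_integral) auto
    finally show ?thesis using r_nonneg by (simp add: ennreal_mult)
  qed
  have nv: "(\<integral>\<^sup>+x. norm (?v i x) \<partial>lborel) = ennreal (r i * r i ^ CARD('n) * (\<integral>x. norm (v x) \<partial>lborel))" for i
  proof -
    have "(\<integral>\<^sup>+x. norm (?v i x) \<partial>lborel) = (\<integral>\<^sup>+x. indicator (ball (a i) (r i)) x * (r i * ennreal (norm (v (inv_chart i x)))) \<partial>lborel)"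
      using lift_term_zero[of v, OF zv] r_nonneg[of i] by (intro nn_integral_cong) (auto simp: indicator_def ennreal_mult)
    also have "\<dots> = ennreal (r i ^ CARD('n)) * (\<integral>\<^sup>+x. indicator (ball 0 1) x * (r i * ennreal (norm (v x))) \<partial>lborel)"
      by (rule nn_integral_ball) measurable
    also have "(\<integral>\<^sup>+x. indicator (ball 0 1) x * (r i * ennreal (norm (v x))) \<partial>lborel) = (\<integral>\<^sup>+x. r i * norm (v x) \<partial>lborel)"
      using zv r_nonneg[of i] by (intro nn_integral_cong) (auto simp: indicator_def ennreal_mult)
    also have "\<dots> = ennreal (\<integral>x. r i * norm (v x) \<partial>lborel)"
      using iv r_nonneg[of i] by (intro nn_integral_eq_integral) auto
    finally show ?thesis using r_nonneg[of i] by (simp add: ennreal_mult mult_ac)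
  qed
  have integral_norm: "(\<integral>x. norm (f x) \<partial>lborel) = c" "integrable lborel f"
    if "(\<integral>\<^sup>+x. norm (f x) \<partial>lborel) = ennreal c" "c \<ge> 0" and [measurable]: "f \<in> borel_measurable borel"
    for f :: "real^'n \<Rightarrow> 'c::euclidean_space" and c
  proof -
    show "(\<integral>x. norm (f x) \<partial>lborel) = c"
      by (subst integral_eq_nn_integral) (use that in auto)
    show "integrable lborel f"
      by (rule integrableI_bounded) (use that in auto)
  qed
  have c0: "0 \<le> r i * r i ^ CARD('n) * (\<integral>x. norm (v x) \<partial>lborel)" "0 \<le> r i ^ CARD('n) * (\<integral>x. norm (V x) \<partial>lborel)" for i
    using r_nonneg[of i] by auto
  have "weak_der (\<lambda>x. \<Sum>i. ?v i x) (\<lambda>x. \<Sum>i. ?V i x)"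
  proof (rule weak_der_suminf)
    show "integrable lborel (?v i)" for i
      by (rule integral_norm(2)[OF nv c0(1)]) measurable
    show "integrable lborel (?V i)" for i
      by (rule integral_norm(2)[OF nV c0(2)]) measurable
    have "(\<integral>x. norm (?V i x) \<partial>lborel) = r i ^ CARD('n) * (\<integral>x. norm (V x) \<partial>lborel)" for i
      by (rule integral_norm(1)[OF nV c0(2)]) measurable
    then show "summable (\<lambda>i. \<integral>x. norm (?V i x) \<partial>lborel)"
      using packing_mass(1) by (simp only: summable_mult2)
    have nv': "(\<integral>x. norm (?v i x) \<partial>lborel) = r i * r i ^ CARD('n) * (\<integral>x. norm (v x) \<partial>lborel)" for i
      by (rule integral_norm(1)[OF nv c0(1)]) measurable
    have "summable (\<lambda>i. r i * r i ^ CARD('n))"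
      by (rule summable_comparison_test'[OF summable_mult[OF packing_mass(1), of \<delta>]])
         (use r_le r_nonneg in \<open>auto intro!: mult_right_mono simp: abs_mult\<close>)
    then show "summable (\<lambda>i. \<integral>x. norm (?v i x) \<partial>lborel)"
      unfolding nv' by (rule summable_mult2)
    show "weak_der (?v i) (?V i)" for i
    proof (cases "r i > 0")
      case True
      have "?V i = (\<lambda>x. V ((x - a i) /\<^sub>R r i))"
        using zV inv_chart_ball[OF True] by (auto simp: indicator_def inv_chart_def)
      moreover have "?v i = (\<lambda>x. r i *\<^sub>R v ((x - a i) /\<^sub>R r i))"
        by (simp add: inv_chart_def)
      moreover have "weak_der (\<lambda>x. r i *\<^sub>R v ((x - a i) /\<^sub>R r i)) (\<lambda>x. V ((x - a i) /\<^sub>R r i))"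
        by (rule weak_der_rescale[OF wd True]) measurable
      ultimately show ?thesis by simp
    next
      case False
      then have "r i = 0" using r_nonneg[of i] by simp
      then show ?thesis
        by (simp add: weak_der_def bounded_bilinear.zero_left[OF bounded_bilinear_outer])
    qed
  qed
  then show ?thesis by (simp add: lift_def[abs_def] pull_def[abs_def])
qed

end

section \<open>The building block\<close>

lemma outer_mult_vec: "outer v d *v h = (d \<bullet> h) *\<^sub>R v"
  by (simp add: vec_eq_iff matrix_vector_mult_def outer_nth inner_vec_def sum_distrib_left sum_distrib_right mult_ac)

lemma scaleR_matrix_vector: "(c *\<^sub>R A) *v x = c *\<^sub>R (A *v (x::real^'n))"
  by (simp add: vec_eq_iff matrix_vector_mult_def sum_distrib_left mult_ac)

lemma det_scaleR: "det (c *\<^sub>R (A::real^'n^'n)) = c ^ CARD('n) * det A"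
proof -
  have "c *\<^sub>R A = (\<chi> i. c *s (A $ i))"
    by (simp add: vec_eq_iff)
  then show ?thesis by (simp add: det_rows_mul)
qed

text \<open>Conjugation by an orthogonal map taking e to a coordinate vector makes the matrix
  diagonal, with one entry 1 - t and all others 1.\<close>

lemma det_mat_minus_outer:
  fixes e :: "real^'n"
  assumes "norm e = 1"
  shows "det (mat 1 - t *\<^sub>R outer e e) = 1 - t"
proof -
  define k :: 'n where "k = undefined"
  define b :: "real^'n" where "b = axis k 1"
  obtain f where f: "orthogonal_transformation f" "f e = b"
    using orthogonal_transformation_exists[of e b] assms by (auto simp: b_def)
  let ?O = "matrix f"
  have O: "?O *v z = f z" for z
    using f(1) orthogonal_transformation_matrix by force
  have ip: "f x \<bullet> f y = x \<bullet> y" for x y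
    using f(1) by (simp add: orthogonal_transformation_def)
  have "?O ** (mat 1 - t *\<^sub>R outer e e) = (mat 1 - t *\<^sub>R outer b b) ** ?O"
  proof (subst matrix_eq, intro allI)
    fix z
    have lin: "linear f" using f(1) by (simp add: orthogonal_transformation_def)
    have "(?O ** (mat 1 - t *\<^sub>R outer e e)) *v z = f (z - (t * (e \<bullet> z)) *\<^sub>R e)"
      by (simp add: O matrix_vector_mul_assoc[symmetric] matrix_vector_mult_diff_rdistrib scaleR_matrix_vector outer_mult_vec)
    also have "\<dots> = f z - (t * (b \<bullet> f z)) *\<^sub>R b"
      using lin ip[of e z] f(2) by (simp add: linear_diff linear_scale)
    also have "\<dots> = ((mat 1 - t *\<^sub>R outer b b) ** ?O) *v z"
      by (simp add: O matrix_vector_mul_assoc[symmetric] matrix_vector_mult_diff_rdistrib scaleR_matrix_vector outer_mult_vec)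
    finally show "(?O ** (mat 1 - t *\<^sub>R outer e e)) *v z = ((mat 1 - t *\<^sub>R outer b b) ** ?O) *v z" .
  qed
  then have "det ?O * det (mat 1 - t *\<^sub>R outer e e) = det (mat 1 - t *\<^sub>R outer b b) * det ?O"
    by (metis det_mul)
  moreover have "det ?O \<noteq> 0"
    using f(1) orthogonal_transformation_matrix det_orthogonal_matrix[of ?O] by force
  ultimately have "det (mat 1 - t *\<^sub>R outer e e) = det (mat 1 - t *\<^sub>R outer b b)"
    by simp
  also have "\<dots> = (\<Prod>i\<in>UNIV. (mat 1 - t *\<^sub>R outer b b) $ i $ i)"
    by (rule det_diagonal) (auto simp: mat_def outer_nth b_def axis_def)
  also have "\<dots> = (\<Prod>i\<in>UNIV. if i = k then 1 - t else 1)"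
    by (intro prod.cong) (auto simp: mat_def outer_nth b_def axis_def)
  also have "\<dots> = 1 - t" by simp
  finally show ?thesis .
qed

text \<open>The sign of the determinant is fixed as nonpositive because the radial block reverses
  orientation. The set is a cone in the sense of invariance under nonnegative scaling, which is what
  passing to the next generation requires.\<close>

definition qr_cone :: "real \<Rightarrow> real^'n^'n \<Rightarrow> bool" where
  "qr_cone K A \<longleftrightarrow> det A \<le> 0 \<and> (\<forall>\<xi> \<eta>. norm \<xi> = 1 \<and> norm \<eta> = 1 \<longrightarrow> norm (A *v \<xi>) \<le> K * norm (A *v \<eta>))"

lemma qr_cone_scaleR:
  assumes "qr_cone K A" "c \<ge> 0"
  shows "qr_cone K (c *\<^sub>R A)"
  using assms mult_left_mono[of "norm (A *v _)" "K * norm (A *v _)" c]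
  by (auto simp: qr_cone_def det_scaleR scaleR_matrix_vector mult_nonpos_nonneg mult_ac)

lemma norm_mat_minus_outer:
  fixes e :: "real^'n"
  assumes "norm e = 1" "norm \<xi> = 1"
  shows "(norm ((mat 1 - t *\<^sub>R outer e e) *v \<xi>))\<^sup>2 = 1 - (1 - (t - 1)\<^sup>2) * (e \<bullet> \<xi>)\<^sup>2"
proof -
  have eq: "(mat 1 - t *\<^sub>R outer e e) *v \<xi> = \<xi> - (t * (e \<bullet> \<xi>)) *\<^sub>R e"
    by (simp add: matrix_vector_mult_diff_rdistrib scaleR_matrix_vector outer_mult_vec)
  have "e \<bullet> e = 1" "\<xi> \<bullet> \<xi> = 1"
    using assms by (auto simp: norm_eq_1)
  then show ?thesis
    unfolding power2_norm_eq_inner eq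
    by (simp add: inner_diff_left inner_diff_right inner_commute power2_eq_square algebra_simps)
qed

text \<open>The matrix is the identity on the orthogonal complement of e and multiplies e by -1/K.
  Unit vectors are therefore stretched by factors between 1/K and 1, and the determinant is
  -1/K.\<close>

lemma qr_cone_mat_minus_outer:
  fixes e :: "real^'n"
  assumes "norm e = 1" "K \<ge> 1"
  shows "qr_cone K (mat 1 - (1 + 1 / K) *\<^sub>R outer e e)"
  unfolding qr_cone_def
proof (intro conjI allI impI)
  show "det (mat 1 - (1 + 1 / K) *\<^sub>R outer e e) \<le> 0"
    using assms by (simp add: det_mat_minus_outer)
  fix \<xi> \<eta> :: "real^'n" assume *: "norm \<xi> = 1 \<and> norm \<eta> = 1"
  let ?A = "mat 1 - (1 + 1 / K) *\<^sub>R outer e e"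
  have k: "(1 / K)\<^sup>2 \<le> 1" using assms(2) by (simp add: power_le_one)
  have e: "(e \<bullet> \<eta>)\<^sup>2 \<le> 1"
    using Cauchy_Schwarz_ineq2[of e \<eta>] assms(1) * by (simp add: abs_square_le_1)
  have "(norm (?A *v \<xi>))\<^sup>2 \<le> 1"
    using norm_mat_minus_outer[OF assms(1), of \<xi> "1 + 1/K"] * k by simp
  then have 1: "norm (?A *v \<xi>) \<le> 1"
    by (simp add: power_le_one_iff abs_square_le_1)
  have "(1 - (1 / K)\<^sup>2) * (e \<bullet> \<eta>)\<^sup>2 \<le> (1 - (1 / K)\<^sup>2) * 1"
    using k e by (intro mult_left_mono) auto
  then have "(1 / K)\<^sup>2 \<le> (norm (?A *v \<eta>))\<^sup>2"
    using norm_mat_minus_outer[OF assms(1), of \<eta> "1 + 1/K"] * by simp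
  then have "1 / K \<le> norm (?A *v \<eta>)"
    using power2_le_imp_le norm_ge_zero by blast
  then have "1 \<le> K * norm (?A *v \<eta>)"
    using assms(2) by (simp add: field_simps)
  with 1 show "norm (?A *v \<xi>) \<le> K * norm (?A *v \<eta>)" by linarith
qed

section \<open>The radial block\<close>

definition clamp_powr :: "real \<Rightarrow> real \<Rightarrow> real" where
  "clamp_powr \<alpha> s = max (1/2) (min 1 s) powr - \<alpha>"

text \<open>The block minus the identity. Clamping the radius to [1/2, 1] makes one formula cover
  the linear inner part, the radial power on the annulus and the identity outside.\<close>

definition core :: "real \<Rightarrow> real^'n \<Rightarrow> real^'n" where
  "core \<alpha> x = (clamp_powr \<alpha> (norm x) - 1) *\<^sub>R x"

definition core_grad :: "real \<Rightarrow> real^'n \<Rightarrow> real^'n^'n" where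
  "core_grad \<alpha> x =
    (if norm x < 1/2 then (2 powr \<alpha> - 1) *\<^sub>R mat 1
     else if norm x < 1 then norm x powr - \<alpha> *\<^sub>R (mat 1 - \<alpha> *\<^sub>R outer (sgn x) (sgn x)) - mat 1
     else 0)"

lemma half_powr_minus: "(1/2::real) powr - \<alpha> = 2 powr \<alpha>"
proof -
  have "(1/2::real) powr - \<alpha> = (2 powr -1) powr - \<alpha>"
    by (simp add: powr_neg_one)
  then show ?thesis by (simp only: powr_powr minus_mult_minus mult_1)
qed

lemma clamp_powr_bounds:
  assumes "\<alpha> > 0"
  shows "1 \<le> clamp_powr \<alpha> s" "clamp_powr \<alpha> s \<le> 2 powr \<alpha>"
proof -
  let ?c = "max (1/2) (min 1 s)"
  have c: "1/2 \<le> ?c" "?c \<le> 1" by auto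
  have "?c powr - \<alpha> \<le> (1/2) powr - \<alpha>"
    using c assms by (intro powr_mono2') auto
  then show "clamp_powr \<alpha> s \<le> 2 powr \<alpha>"
    by (simp only: clamp_powr_def half_powr_minus)
  have "1 powr - \<alpha> \<le> ?c powr - \<alpha>"
    using c assms by (intro powr_mono2') auto
  then show "1 \<le> clamp_powr \<alpha> s" by (simp add: clamp_powr_def)
qed

text \<open>The clamp does not increase distances, and on [1/2, 1] the derivative of the power is
  largest in size at 1/2, where it equals \<alpha> 2^(\<alpha> + 1).\<close>

lemma clamp_powr_lipschitz:
  assumes "\<alpha> > 0"
  shows "\<bar>clamp_powr \<alpha> s - clamp_powr \<alpha> t\<bar> \<le> \<alpha> * 2 powr (\<alpha> + 1) * \<bar>s - t\<bar>"
proof -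
  let ?c = "\<lambda>s. max (1/2) (min 1 s :: real)"
  have "norm (?c s powr - \<alpha> - ?c t powr - \<alpha>) \<le> \<alpha> * 2 powr (\<alpha> + 1) * norm (?c s - ?c t)"
  proof (rule field_differentiable_bound[where S="{1/2..1}" and f="\<lambda>z. z powr - \<alpha>"
        and f'="\<lambda>z. - \<alpha> * z powr (- \<alpha> - 1)"])
    fix z :: real assume z: "z \<in> {1/2..1}"
    show "((\<lambda>z. z powr - \<alpha>) has_field_derivative (- \<alpha> * z powr (- \<alpha> - 1))) (at z within {1/2..1})"
      by (rule has_field_derivative_at_within[OF has_real_derivative_powr]) (use z in simp)
    have "z powr (- \<alpha> - 1) \<le> (1/2) powr (- \<alpha> - 1)"
      using z assms by (intro powr_mono2') auto
    also have "\<dots> = 2 powr (\<alpha> + 1)"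
      using half_powr_minus[of "\<alpha> + 1"] by simp
    finally show "norm (- \<alpha> * z powr (- \<alpha> - 1)) \<le> \<alpha> * 2 powr (\<alpha> + 1)"
      using assms by (simp add: abs_mult)
  qed auto
  also have "\<dots> \<le> \<alpha> * 2 powr (\<alpha> + 1) * \<bar>s - t\<bar>"
    using assms by (intro mult_left_mono) auto
  finally show ?thesis by (simp add: clamp_powr_def)
qed

lemma core_outside: "norm x \<ge> 1 \<Longrightarrow> core \<alpha> x = 0"
  by (simp add: core_def clamp_powr_def)

lemma core_lipschitz:
  fixes x y :: "real^'n"
  assumes "\<alpha> > 0"
  shows "norm (core \<alpha> x - core \<alpha> y) \<le> (2 powr \<alpha> + \<alpha> * 2 powr (\<alpha> + 1)) * norm (x - y)"
proof -
  let ?m = "\<lambda>x::real^'n. clamp_powr \<alpha> (norm x)"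
  let ?L = "\<alpha> * 2 powr (\<alpha> + 1)"
  \<comment> \<open>The second term of the splitting contains y itself, so y is taken in the unit
    ball; when both points lie outside, both values vanish.\<close>
  have half: "norm (core \<alpha> x - core \<alpha> y) \<le> (2 powr \<alpha> + ?L) * norm (x - y)" if y: "norm y < 1" for x y :: "real^'n"
  proof -
    have "core \<alpha> x - core \<alpha> y = (?m x - 1) *\<^sub>R (x - y) + (?m x - ?m y) *\<^sub>R y"
      by (simp add: core_def algebra_simps)
    also have "norm \<dots> \<le> \<bar>?m x - 1\<bar> * norm (x - y) + \<bar>?m x - ?m y\<bar> * norm y"
      by (rule order_trans[OF norm_triangle_ineq]) simp
    also have "\<dots> \<le> 2 powr \<alpha> * norm (x - y) + (?L * norm (x - y)) * 1"
    proof (intro add_mono mult_mono)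
      show "\<bar>?m x - 1\<bar> \<le> 2 powr \<alpha>"
        using clamp_powr_bounds[OF assms, of "norm x"] by simp
      have "\<bar>?m x - ?m y\<bar> \<le> ?L * \<bar>norm x - norm y\<bar>"
        by (rule clamp_powr_lipschitz[OF assms])
      also have "\<dots> \<le> ?L * norm (x - y)"
        using assms by (intro mult_left_mono norm_triangle_ineq3) auto
      finally show "\<bar>?m x - ?m y\<bar> \<le> ?L * norm (x - y)" .
    qed (use y assms in auto)
    finally show ?thesis by (simp add: algebra_simps)
  qed
  consider "norm y < 1" | "norm x < 1" | "norm x \<ge> 1" "norm y \<ge> 1" by linarith
  then show ?thesis
  proof cases
    case 2
    then show ?thesis using half[of x y] by (simp add: norm_minus_commute)
  next
    case 3
    then show ?thesis using assms by (simp add: core_outside)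
  qed (use half in auto)
qed

lemma core_bounded:
  assumes "\<alpha> > 0"
  shows "norm (core \<alpha> x) \<le> 2 powr \<alpha>"
proof (cases "norm x < 1")
  case True
  have "norm (core \<alpha> x) \<le> 2 powr \<alpha> * 1"
    unfolding core_def norm_scaleR using True clamp_powr_bounds[OF assms, of "norm x"]
    by (intro mult_mono) auto
  then show ?thesis by simp
qed (simp add: core_outside)

lemma core_grad_bounded:
  fixes x :: "real^'n"
  assumes "\<alpha> > 0"
  shows "norm (core_grad \<alpha> x) \<le> 2 powr \<alpha> * (norm (mat 1 :: real^'n^'n) + \<alpha>) + norm (mat 1 :: real^'n^'n)"
proof -
  let ?I = "mat 1 :: real^'n^'n"
  have p: "2 powr \<alpha> \<ge> 1" using assms by (simp add: ge_one_powr_ge_zero)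
  consider "norm x < 1/2" | "1/2 \<le> norm x" "norm x < 1" | "norm x \<ge> 1" by linarith
  then show ?thesis
  proof cases
    case 1
    then have "norm (core_grad \<alpha> x) = (2 powr \<alpha> - 1) * norm ?I"
      using p by (simp add: core_grad_def)
    also have "\<dots> \<le> 2 powr \<alpha> * (norm ?I + \<alpha>)"
      using p assms by (intro mult_mono) auto
    finally show ?thesis using norm_ge_zero[of ?I] by linarith
  next
    case 2
    have "norm x powr - \<alpha> \<le> (1/2) powr - \<alpha>"
      using 2 assms by (intro powr_mono2') auto
    then have q: "norm x powr - \<alpha> \<le> 2 powr \<alpha>" by (simp only: half_powr_minus)
    have s: "norm (outer (sgn x) (sgn x)) = 1"
      using 2 by (auto simp: norm_outer norm_sgn)
    have "norm (?I - \<alpha> *\<^sub>R outer (sgn x) (sgn x)) \<le> norm ?I + \<alpha>"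
      using norm_triangle_ineq4[of ?I "\<alpha> *\<^sub>R outer (sgn x) (sgn x)"] s assms by simp
    then have "norm (norm x powr - \<alpha> *\<^sub>R (?I - \<alpha> *\<^sub>R outer (sgn x) (sgn x))) \<le> 2 powr \<alpha> * (norm ?I + \<alpha>)"
      unfolding norm_scaleR using q assms by (intro mult_mono) auto
    then show ?thesis
      using 2 norm_triangle_ineq4[of "norm x powr - \<alpha> *\<^sub>R (?I - \<alpha> *\<^sub>R outer (sgn x) (sgn x))" ?I]
      by (simp add: core_grad_def)
  next
    case 3
    then show ?thesis using assms p by (simp add: core_grad_def)
  qed
qed

lemma core_grad_measurable[measurable]: "core_grad \<alpha> \<in> borel_measurable borel"
  unfolding core_grad_def sgn_div_norm by measurable

lemma core_has_derivative:
  fixes x :: "real^'n"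
  assumes "norm x \<noteq> 1/2" "norm x \<noteq> 1"
  shows "(core \<alpha> has_derivative (\<lambda>h. core_grad \<alpha> x *v h)) (at x)"
proof -
  consider "norm x < 1/2" | "1/2 < norm x" "norm x < 1" | "norm x > 1" using assms by linarith
  then show ?thesis
  proof cases
    case 1
    have "((\<lambda>y. (2 powr \<alpha> - 1) *\<^sub>R y) has_derivative (\<lambda>h. core_grad \<alpha> x *v h)) (at x)"
      using 1 by (auto intro!: derivative_eq_intros simp: core_grad_def scaleR_matrix_vector)
    then show ?thesis
    proof (rule has_derivative_transform_within_open)
      show "open (ball (0::real^'n) (1/2))" by simp
      show "(2 powr \<alpha> - 1) *\<^sub>R y = core \<alpha> y" if "y \<in> ball 0 (1/2)" for y :: "real^'n"
        using that by (simp add: core_def clamp_powr_def half_powr_minus)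
    qed (use 1 in simp)
  next
    case 2
    then have x0: "x \<noteq> 0" and nx: "norm x > 0" by auto
    have d1: "(norm has_derivative (\<lambda>h. h \<bullet> sgn x)) (at x)"
      using has_derivative_norm[OF x0] .
    have d2: "((\<lambda>z. z powr - \<alpha>) has_derivative (\<lambda>t. t * (- \<alpha> * norm x powr (- \<alpha> - 1)))) (at (norm x))"
      by (rule has_derivative_eq_rhs[OF has_real_derivative_powr[OF nx, of "- \<alpha>", unfolded has_field_derivative_def]])
         (simp add: fun_eq_iff)
    have d3: "((\<lambda>y. norm y powr - \<alpha> - 1) has_derivative (\<lambda>h. (h \<bullet> sgn x) * (- \<alpha> * norm x powr (- \<alpha> - 1)))) (at x)"
      by (rule has_derivative_eq_rhs[OF has_derivative_diff[OF has_derivative_compose[OF d1 d2] has_derivative_const]]) simp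
    \<comment> \<open>Replacing x by |x| times its direction raises the power -\<alpha> - 1 back to
      -\<alpha> and turns the radial derivative into the rank-one term of
      \<open>core_grad\<close>.\<close>
    have x: "x = norm x *\<^sub>R sgn x" using x0 by (simp add: sgn_div_norm)
    have pw: "norm x powr (- \<alpha> - 1) * norm x = norm x powr - \<alpha>"
      using nx by (simp add: powr_diff)
    have "((\<lambda>y. (norm y powr - \<alpha> - 1) *\<^sub>R y) has_derivative (\<lambda>h. core_grad \<alpha> x *v h)) (at x)"
    proof (rule has_derivative_eq_rhs[OF has_derivative_scaleR[OF d3 has_derivative_ident]], rule ext)
      fix h
      have "((h \<bullet> sgn x) * (- \<alpha> * norm x powr (- \<alpha> - 1))) *\<^sub>R x
        = ((h \<bullet> sgn x) * (- \<alpha> * norm x powr (- \<alpha> - 1))) *\<^sub>R (norm x *\<^sub>R sgn x)"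
        using x by simp
      also have "\<dots> = - (\<alpha> * (h \<bullet> sgn x) * (norm x powr (- \<alpha> - 1) * norm x)) *\<^sub>R sgn x"
        by (simp add: mult_ac)
      finally have "((h \<bullet> sgn x) * (- \<alpha> * norm x powr (- \<alpha> - 1))) *\<^sub>R x
        = - (\<alpha> * (h \<bullet> sgn x) * norm x powr - \<alpha>) *\<^sub>R sgn x"
        unfolding pw .
      then show "(norm x powr - \<alpha> - 1) *\<^sub>R h + ((h \<bullet> sgn x) * (- \<alpha> * norm x powr (- \<alpha> - 1))) *\<^sub>R x = core_grad \<alpha> x *v h"
        using 2 by (simp add: core_grad_def matrix_vector_mult_diff_rdistrib scaleR_matrix_vector outer_mult_vec
            inner_commute algebra_simps)
    qed
    then show ?thesis
    proof (rule has_derivative_transform_within_open)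
      show "open (ball (0::real^'n) 1 - cball 0 (1/2))" by (simp add: open_Diff)
      show "(norm y powr - \<alpha> - 1) *\<^sub>R y = core \<alpha> y" if "y \<in> ball 0 1 - cball 0 (1/2)" for y :: "real^'n"
        using that by (simp add: core_def clamp_powr_def)
    qed (use 2 in simp)
  next
    case 3
    have "((\<lambda>y. 0) has_derivative (\<lambda>h. core_grad \<alpha> x *v h)) (at x)"
      using 3 by (simp add: core_grad_def)
    then show ?thesis
    proof (rule has_derivative_transform_within_open)
      show "open (- cball (0::real^'n) 1)" by (simp add: open_Compl)
      show "0 = core \<alpha> y" if "y \<in> - cball 0 1" for y :: "real^'n"
        using that by (simp add: core_outside)
    qed (use 3 in simp)
  qed
qed

lemma sphere_null: "sphere (a::real^'n) \<rho> \<in> null_sets lborel"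
  by (intro null_sets_lborel_negligible) (auto simp: negligible_sphere)

text \<open>The block is Lipschitz and classically differentiable off two spheres, which are
  null.\<close>

lemma weak_der_core:
  assumes "\<alpha> > 0"
  shows "weak_der (core \<alpha> :: real^'n \<Rightarrow> real^'n) (core_grad \<alpha>)"
proof (rule weak_der_lipschitz)
  show "AE x in lborel. (core \<alpha> has_derivative (\<lambda>h. core_grad \<alpha> x *v h)) (at (x::real^'n))"
    using AE_not_in[OF sphere_null[of 0 "1/2"]] AE_not_in[OF sphere_null[of 0 1]]
    by eventually_elim (auto intro: core_has_derivative)
qed (use core_lipschitz[OF assms] core_grad_bounded[OF assms] in auto)

lemma core_grad_inner: "norm x < 1/2 \<Longrightarrow> mat 1 + core_grad \<alpha> x = 2 powr \<alpha> *\<^sub>R mat 1"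
  by (simp add: core_grad_def algebra_simps)

lemma core_grad_outside: "norm x \<ge> 1 \<Longrightarrow> core_grad \<alpha> x = 0"
  by (simp add: core_grad_def)

lemma core_grad_qr_cone:
  assumes "1/2 < norm x" "norm x < 1" "K \<ge> 1"
  shows "qr_cone K (mat 1 + core_grad (1 + 1 / K) x)"
proof -
  have "norm (sgn x) = 1" using assms(1) by (auto simp: norm_sgn)
  then have "qr_cone K (norm x powr - (1 + 1 / K) *\<^sub>R (mat 1 - (1 + 1 / K) *\<^sub>R outer (sgn x) (sgn x)))"
    by (intro qr_cone_scaleR qr_cone_mat_minus_outer assms) auto
  then show ?thesis using assms(1,2) by (simp add: core_grad_def)
qed

section \<open>The self-similar iteration\<close>

text \<open>The packed ball is the one on which the block is multiplication by
  \<open>2 powr (1 + 1 / K)\<close>. A further generation multiplies sup norms by at most this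
  number times \<delta>, which \<open>delta_small\<close> caps at 1/2.\<close>

locale qr_iteration = ball_packing a r "ball 0 (1/2)" \<delta>
  for a :: "nat \<Rightarrow> real^'n" and r :: "nat \<Rightarrow> real" and \<delta> :: real +
  fixes K :: real
  assumes K_ge: "K \<ge> 1" and delta_small: "2 powr (1 + 1 / K) * \<delta> \<le> 1/2" and card_ge: "CARD('n) \<ge> 3"
begin

definition \<alpha> where "\<alpha> = 1 + 1 / K"

definition \<Lambda> :: real where "\<Lambda> = 2 powr \<alpha>"

lemma \<alpha>_bounds: "1 < \<alpha>" "\<alpha> \<le> 2"
  using K_ge by (auto simp: \<alpha>_def)

lemma \<Lambda>_gt_1: "1 < \<Lambda>"
  using \<alpha>_bounds by (simp add: \<Lambda>_def)

lemma mass_eq: "mass = (1/2) ^ CARD('n)"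
proof -
  have "measure lborel (ball (0::real^'n) 1) > 0"
    using content_ball_pos[of 1 "0::real^'n"] by simp
  then show ?thesis
    using content_ball_conv_unit_ball[of "1/2" "0::real^'n"] by (simp add: mass_def)
qed

text \<open>K \<ge> 1 gives \<Lambda> \<le> 4 and n \<ge> 3 gives a mass of at most 1/8. The product
  is the ratio of the L1 norms of consecutive gradient corrections.\<close>

lemma \<Lambda>_mass: "\<Lambda> * mass < 1"
proof -
  have "\<Lambda> \<le> 2 powr 2"
    unfolding \<Lambda>_def using \<alpha>_bounds by (intro powr_mono) auto
  moreover have "mass \<le> (1/2) ^ 3"
    unfolding mass_eq using card_ge by (intro power_decreasing) auto
  ultimately have "\<Lambda> * mass \<le> 2 powr 2 * (1/2) ^ 3"
    using packing_mass(3) by (intro mult_mono) auto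
  also have "\<dots> < 1" by (simp add: power3_eq_cube)
  finally show ?thesis .
qed

text \<open>In a packing ball with centre a and radius r, the linear map \<Lambda>x is replaced by
  \<Lambda>(a + r g((x - a)/r)). For g = id + w this is \<Lambda>x plus \<Lambda> r w((x - a)/r), so
  the correction w of one generation becomes \<Lambda> times its lift in the next.\<close>

primrec v :: "nat \<Rightarrow> real^'n \<Rightarrow> real^'n" where
  "v 0 = core \<alpha>"
| "v (Suc k) = (\<lambda>x. \<Lambda> *\<^sub>R lift (v k) x)"

primrec V :: "nat \<Rightarrow> real^'n \<Rightarrow> real^'n^'n" where
  "V 0 = core_grad \<alpha>"
| "V (Suc k) = (\<lambda>x. \<Lambda> *\<^sub>R pull (V k) x)"

definition u where "u x = (\<Sum>k. v k x)"

definition U where "U x = (\<Sum>k. V k x)"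

section \<open>Convergence of the corrections and of their gradients\<close>

lemma norm_less_if_in_\<U>: "x \<in> \<U> \<Longrightarrow> norm x < 1/2"
  using \<U>_subset by auto

lemma in_\<U>: "x \<in> ball (a i) (r i) \<Longrightarrow> x \<in> \<U>"
  by (auto simp: \<U>_def)

lemma v_zero: "y \<notin> ball 0 1 \<Longrightarrow> v k y = 0"
proof (induction k arbitrary: y)
  case 0
  then show ?case by (simp add: core_outside)
next
  case (Suc k)
  have "y \<notin> \<U>" using Suc.prems norm_less_if_in_\<U>[of y] by auto
  have "lift (v k) y = 0" by (rule lift_out[OF Suc.IH \<open>y \<notin> \<U>\<close>])
  then show ?case by simp
qed

lemma V_zero: "y \<notin> ball 0 1 \<Longrightarrow> V k y = 0"
proof (cases k)
  case 0
  then show "y \<notin> ball 0 1 \<Longrightarrow> V k y = 0" by (simp add: core_grad_outside)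
next
  case (Suc m)
  assume "y \<notin> ball 0 1"
  then have "y \<notin> \<U>" using norm_less_if_in_\<U>[of y] by auto
  then show "V k y = 0" using Suc by (simp add: pull_out)
qed

lemma v_bound: "norm (v k y) \<le> \<Lambda> * (1/2) ^ k"
proof (induction k arbitrary: y)
  case 0
  then show ?case using core_bounded[of \<alpha> y] \<alpha>_bounds by (simp add: \<Lambda>_def)
next
  case (Suc k)
  have "norm (v (Suc k) y) = \<Lambda> * norm (lift (v k) y)"
    using \<Lambda>_gt_1 by simp
  also have "\<dots> \<le> \<Lambda> * (\<delta> * (\<Lambda> * (1/2) ^ k))"
    using \<Lambda>_gt_1 by (intro mult_left_mono lift_norm_le[OF v_zero Suc.IH]) auto
  also have "\<dots> = (\<Lambda> * \<delta>) * (\<Lambda> * (1/2) ^ k)"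
    by simp
  also have "\<dots> \<le> (1/2) * (\<Lambda> * (1/2) ^ k)"
    using delta_small \<Lambda>_gt_1 by (intro mult_right_mono) (auto simp: \<Lambda>_def \<alpha>_def)
  finally show ?case by simp
qed

lemma v_continuous: "continuous_on UNIV (v k)"
proof (induction k)
  case 0
  show ?case
    using norm_lipschitz_imp_continuous[OF core_lipschitz[of \<alpha>]] \<alpha>_bounds by simp
next
  case (Suc k)
  have "continuous_on UNIV (lift (v k))"
    by (rule lift_continuous[OF Suc v_zero v_bound])
  then show ?case by (simp add: continuous_on_scaleR continuous_on_const)
qed

lemma v_measurable[measurable]: "v k \<in> borel_measurable borel"
  using v_continuous by (rule borel_measurable_continuous_onI)

lemma V_measurable[measurable]: "V k \<in> borel_measurable borel"
  by (induction k) auto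

lemma v_integrable: "integrable lborel (v k)"
  by (rule integrable_bounded_zero_outside[where R=1, OF v_measurable v_bound]) (simp add: v_zero)

lemma V_integrable: "integrable lborel (V k)"
proof (induction k)
  case 0
  show ?case
    using core_grad_bounded[of \<alpha>] \<alpha>_bounds
    by (intro integrable_bounded_zero_outside[where R=1, OF V_measurable]) (auto simp: core_grad_outside)
next
  case (Suc k)
  have "integrable lborel (pull (V k))"
    by (rule integral_norm_pull(1)[OF Suc V_zero])
  then show ?case by simp
qed

text \<open>Copying multiplies the L1 norm of a gradient exactly by the mass of the packing, and the
  scaling contributes \<Lambda>.\<close>

lemma V_integral_norm: "(\<integral>x. norm (V k x) \<partial>lborel) = (\<Lambda> * mass) ^ k * (\<integral>x. norm (V 0 x) \<partial>lborel)"
proof (induction k)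
  case (Suc k)
  have "(\<integral>x. norm (V (Suc k) x) \<partial>lborel) = \<Lambda> * (\<integral>x. norm (pull (V k) x) \<partial>lborel)"
    using \<Lambda>_gt_1 by simp
  also have "(\<integral>x. norm (pull (V k) x) \<partial>lborel) = mass * (\<integral>x. norm (V k x) \<partial>lborel)"
    by (rule integral_norm_pull(2)[OF V_integrable V_zero])
  finally show ?case unfolding Suc by simp
qed simp

lemma weak_der_v: "weak_der (v k) (V k)"
proof (induction k)
  case 0
  show ?case using weak_der_core[of \<alpha>] \<alpha>_bounds by simp
next
  case (Suc k)
  have "weak_der (lift (v k)) (pull (V k))"
    by (rule weak_der_lift[OF Suc v_integrable V_integrable v_zero V_zero])
  then show ?case using weak_der_scaleR by simp
qed

lemma summable_V_norm: "summable (\<lambda>k. \<integral>x. norm (V k x) \<partial>lborel)"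
proof -
  have "summable (\<lambda>k. (\<Lambda> * mass) ^ k)"
    using \<Lambda>_mass \<Lambda>_gt_1 packing_mass(3) by (intro summable_geometric) simp
  then have "summable (\<lambda>k. (\<Lambda> * mass) ^ k * (\<integral>x. norm (V 0 x) \<partial>lborel))"
    by (rule summable_mult2)
  moreover have "(\<lambda>k. \<integral>x. norm (V k x) \<partial>lborel) = (\<lambda>k. (\<Lambda> * mass) ^ k * (\<integral>x. norm (V 0 x) \<partial>lborel))"
    by (rule ext) (rule V_integral_norm)
  ultimately show ?thesis by metis
qed

lemma summable_v_norm: "summable (\<lambda>k. \<integral>x. norm (v k x) \<partial>lborel)"
proof (rule summable_comparison_test')
  let ?C = "\<integral>x. indicat_real (cball (0::real^'n) 1) x \<partial>lborel"
  show "summable (\<lambda>k. (\<Lambda> * ?C) * (1/2) ^ k)"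
    by (intro summable_mult summable_geometric) simp
  fix k
  have "(\<integral>x. norm (v k x) \<partial>lborel) \<le> (\<integral>x. (\<Lambda> * (1/2) ^ k) * indicator (cball (0::real^'n) 1) x \<partial>lborel)"
  proof (rule integral_mono)
    show "integrable lborel (\<lambda>x. norm (v k x))" using v_integrable by simp
    show "integrable lborel (\<lambda>x. (\<Lambda> * (1/2) ^ k) * indicat_real (cball (0::real^'n) 1) x)"
      by (rule integrable_cball_indicator)
    show "norm (v k x) \<le> (\<Lambda> * (1/2) ^ k) * indicator (cball 0 1) x" for x
      using v_bound[of k x] v_zero[of x k] by (cases "norm x \<le> 1") auto
  qed
  also have "\<dots> = (\<Lambda> * ?C) * (1/2) ^ k" by simp
  finally show "norm (\<integral>x. norm (v k x) \<partial>lborel) \<le> (\<Lambda> * ?C) * (1/2) ^ k" by simp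
qed

lemma weak_der_u: "weak_der u U"
  unfolding u_def[abs_def] U_def[abs_def]
  by (rule weak_der_suminf[OF weak_der_v v_integrable V_integrable summable_v_norm summable_V_norm])

lemma U_integrable: "integrable lborel U"
  unfolding U_def[abs_def]
  by (rule integrable_suminf[OF V_integrable AE_summable_norm[OF V_integrable summable_V_norm] summable_V_norm])

lemma u_zero: "y \<notin> ball 0 1 \<Longrightarrow> u y = 0"
  by (simp add: u_def v_zero)

lemma U_zero: "y \<notin> ball 0 1 \<Longrightarrow> U y = 0"
  by (simp add: U_def V_zero)

lemma summable_bound: "summable (\<lambda>k. \<Lambda> * (1/2) ^ k)"
  by (intro summable_mult summable_geometric) simp

lemma u_continuous: "continuous_on UNIV u"
  unfolding u_def[abs_def]
proof (rule uniform_limit_theorem[OF _ Weierstrass_m_test[OF v_bound summable_bound]])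
  show "\<forall>\<^sub>F n in sequentially. continuous_on UNIV (\<lambda>x. \<Sum>i<n. v i x)"
    by (intro always_eventually allI continuous_on_sum v_continuous)
qed auto

lemma u_bound: "norm (u x) \<le> 2 * \<Lambda>"
proof -
  have s: "summable (\<lambda>k. norm (v k x))"
    by (rule summable_comparison_test'[OF summable_bound]) (simp add: v_bound)
  have "norm (u x) \<le> (\<Sum>k. norm (v k x))"
    unfolding u_def by (rule summable_norm[OF s])
  also have "\<dots> \<le> (\<Sum>k. \<Lambda> * (1/2) ^ k)"
    by (rule suminf_le[OF v_bound s summable_bound])
  also have "\<dots> = 2 * \<Lambda>"
    by (subst suminf_mult) (auto simp: suminf_geometric summable_geometric)
  finally show ?thesis .
qed

lemma u_integrable: "integrable lborel u"
  by (rule integrable_bounded_zero_outside[where R=1, OF borel_measurable_continuous_onI[OF u_continuous] u_bound])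
     (simp add: u_zero)

text \<open>\<open>F m\<close> contains the points that, up to the null sets collected from \<open>Z\<close>, still lie in a ball of
  generation \<open>m\<close>. Outside \<open>F m\<close> the partial sum \<open>S m\<close> below is final.\<close>

definition Z where "Z = sphere 0 (1/2) \<union> (ball 0 (1/2) - \<U>)"

primrec F :: "nat \<Rightarrow> (real^'n) set" where
  "F 0 = ball 0 1"
| "F (Suc m) = Z \<union> (\<Union>i. ball (a i) (r i) \<inter> inv_chart i -` F m)"

lemma Z_null: "Z \<in> null_sets lborel"
  unfolding Z_def by (intro null_sets.Un sphere_null null_uncovered)

lemma F_sets[measurable]: "F m \<in> sets borel"
proof (induction m)
  case (Suc m)
  have "inv_chart i -` F m \<in> sets borel" for i
    using measurable_sets[OF measurable_inv_chart Suc] by simp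
  moreover have "Z \<in> sets borel" using Z_null by auto
  ultimately show ?case by auto
qed auto

text \<open>Up to the null set Z, the next set consists of copies of the previous one, so its
  measure is reduced by the factor \<open>mass\<close>.\<close>

lemma F_emeasure: "emeasure lborel (F m) \<le> ennreal (mass ^ m) * emeasure lborel (ball (0::real^'n) 1)"
proof (induction m)
  case (Suc m)
  let ?X = "\<Union>i. ball (a i) (r i) \<inter> inv_chart i -` F m"
  have [measurable]: "?X \<in> sets borel"
    using measurable_sets[OF measurable_inv_chart F_sets] by auto
  have "emeasure lborel (F (Suc m)) \<le> emeasure lborel Z + emeasure lborel ?X"
    unfolding F.simps using Z_null by (intro emeasure_subadditive) auto
  also have "\<dots> = emeasure lborel ?X"
    using Z_null by (simp add: null_setsD1)
  also have "\<dots> = (\<integral>\<^sup>+x. indicator \<U> x * indicator ?X x \<partial>lborel)"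
  proof -
    have "(\<lambda>x. indicator \<U> x * indicator ?X x :: ennreal) = indicator ?X"
      by (auto simp: indicator_def fun_eq_iff \<U>_def)
    then show ?thesis by simp
  qed
  also have "\<dots> = ennreal mass * (\<integral>\<^sup>+x. indicator (ball 0 1) x * indicator (F m) x \<partial>lborel)"
  proof (rule nn_integral_packing)
    show "AE x in lborel. \<forall>i. x \<in> ball (a i) (r i) \<longrightarrow> (indicator ?X x :: ennreal) = indicator (F m) (inv_chart i x)"
      using ball_unique by (intro AE_I2 allI impI) (auto simp: indicator_def simp del: mem_ball)
  qed measurable
  also have "\<dots> \<le> ennreal mass * (\<integral>\<^sup>+x. indicator (F m) x \<partial>lborel)"
    by (intro mult_left_mono nn_integral_mono) (auto simp: indicator_def)
  also have "\<dots> = ennreal mass * emeasure lborel (F m)" by simp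
  also have "\<dots> \<le> ennreal mass * (ennreal (mass ^ m) * emeasure lborel (ball (0::real^'n) 1))"
    by (intro mult_left_mono Suc) auto
  also have "\<dots> = ennreal (mass ^ Suc m) * emeasure lborel (ball (0::real^'n) 1)"
    using packing_mass(3) by (simp add: ennreal_mult mult_ac)
  finally show ?case .
qed simp

text \<open>The points for which no partial sum is certified as final: those lying in balls of every
  generation, together with all copies of Z. The sets \<open>F m\<close> have geometrically
  decreasing measure bounds, so N is null.\<close>

definition N where "N = (\<Inter>m. F m)"

lemma N_null: "N \<in> null_sets lborel"
proof -
  let ?w = "measure lborel (ball (0::real^'n) 1)"
  have w: "emeasure lborel (ball (0::real^'n) 1) = ennreal ?w"
    using emeasure_lborel_ball_finite[of "0::real^'n" 1] by (intro emeasure_eq_ennreal_measure) simp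
  have [measurable]: "N \<in> sets borel" unfolding N_def by measurable
  have "emeasure lborel N \<le> ennreal (mass ^ m * ?w)" for m
  proof -
    have "emeasure lborel N \<le> emeasure lborel (F m)"
      by (intro emeasure_mono) (auto simp: N_def)
    then show ?thesis using F_emeasure[of m] packing_mass(3) unfolding w by (simp add: ennreal_mult)
  qed
  moreover have "(\<lambda>m. mass ^ m * ?w) \<longlonglongrightarrow> 0"
    unfolding mass_eq
    by (intro tendsto_mult_left_zero LIMSEQ_power_zero) (simp add: power_less_one_iff)
  then have "(\<lambda>m. ennreal (mass ^ m * ?w)) \<longlonglongrightarrow> ennreal 0"
    by (rule tendsto_ennrealI)
  ultimately have "emeasure lborel N \<le> ennreal 0"
    by (intro LIMSEQ_le_const) auto
  then show ?thesis by (auto simp: null_sets_def)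
qed

section \<open>Pointwise structure of the limit gradient\<close>

definition S where "S m x = (\<Sum>k<m. V k x)"

lemma S_measurable[measurable]: "S m \<in> borel_measurable borel"
  unfolding S_def[abs_def] by measurable

lemma S_Suc: "S (Suc m) x = core_grad \<alpha> x + (\<Sum>k<m. V (Suc k) x)"
  unfolding S_def by (simp only: sum.lessThan_Suc_shift V.simps(1))

text \<open>In a packing ball the identity plus the first block is \<Lambda> times the identity, and
  all later terms carry a factor \<Lambda>; hence the whole partial sum is \<Lambda> times a copy
  with one term fewer.\<close>

lemma S_Suc_in:
  assumes "x \<in> ball (a i) (r i)"
  shows "mat 1 + S (Suc m) x = \<Lambda> *\<^sub>R (mat 1 + S m (inv_chart i x))"
proof -
  have "(\<Sum>k<m. V (Suc k) x) = \<Lambda> *\<^sub>R S m (inv_chart i x)"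
    by (simp add: pull_in[OF assms] S_def scaleR_sum_right)
  then show ?thesis
    using core_grad_inner[of x \<alpha>] norm_less_if_in_\<U>[OF in_\<U>[OF assms]]
    by (simp add: S_Suc \<Lambda>_def scaleR_add_right flip: add.assoc)
qed

lemma S_Suc_out: "x \<notin> \<U> \<Longrightarrow> S (Suc m) x = core_grad \<alpha> x"
  by (simp add: S_Suc pull_out)

text \<open>Induction on the generation. A point off the packing and off Z lies in the open annulus,
  where the block itself is in the cone; a point in a packing ball is handled through its chart and
  scaling invariance. For m = 0 the claim is vacuous, as \<open>F 0\<close> is the unit
  ball.\<close>

lemma qr_cone_partial_sum:
  assumes "x \<in> ball 0 1" "x \<notin> F m"
  shows "qr_cone K (mat 1 + S m x) \<and> (\<forall>k\<ge>m. V k x = 0)"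
  using assms
proof (induction m arbitrary: x)
  case (Suc m)
  show ?case
  proof (cases "x \<in> \<U>")
    case True
    then obtain i where i: "x \<in> ball (a i) (r i)" by (auto simp: \<U>_def)
    then have "inv_chart i x \<notin> F m" using Suc.prems by auto
    from Suc.IH[OF inv_chart_in_ball[OF i] this]
    have IH: "qr_cone K (mat 1 + S m (inv_chart i x))" "\<forall>k\<ge>m. V k (inv_chart i x) = 0" by auto
    have "V k x = 0" if "k \<ge> Suc m" for k
      using that IH(2) by (cases k) (auto simp: pull_in[OF i])
    then show ?thesis
      using S_Suc_in[OF i, of m] qr_cone_scaleR[OF IH(1), of \<Lambda>] \<Lambda>_gt_1 by simp
  next
    case False
    then have "1/2 < norm x" "norm x < 1"
      using Suc.prems by (auto simp: Z_def)
    then have "qr_cone K (mat 1 + core_grad \<alpha> x)"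
      using core_grad_qr_cone[OF _ _ K_ge] by (simp add: \<alpha>_def)
    moreover have "V k x = 0" if "k \<ge> Suc m" for k
      using that False by (cases k) (auto simp: pull_out)
    ultimately show ?thesis using S_Suc_out[OF False] by simp
  qed
qed simp

lemma U_eq_S:
  assumes "x \<in> ball 0 1" "x \<notin> F m" "n \<ge> m"
  shows "U x = S n x"
proof -
  have "V k x = 0" if "k \<notin> {..<n}" for k
    using qr_cone_partial_sum[OF assms(1,2)] that assms(3) by auto
  then show ?thesis unfolding U_def S_def by (intro suminf_finite) auto
qed

lemma U_qr_cone:
  assumes "x \<in> ball 0 1" "x \<notin> N"
  shows "qr_cone K (mat 1 + U x)"
proof -
  obtain m where "x \<notin> F m" using assms(2) by (auto simp: N_def)
  then show ?thesis using qr_cone_partial_sum[OF assms(1), of m] U_eq_S[OF assms(1), of m m] by simp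
qed

lemma U_self_similar:
  assumes "x \<in> ball (a i) (r i)" "x \<notin> N"
  shows "mat 1 + U x = \<Lambda> *\<^sub>R (mat 1 + U (inv_chart i x))"
proof -
  have x: "x \<in> ball 0 1" using norm_less_if_in_\<U>[OF in_\<U>[OF assms(1)]] by simp
  obtain n where "x \<notin> F n" using assms(2) by (auto simp: N_def)
  \<comment> \<open>The index is a successor because x lies in \<open>F 0\<close>.\<close>
  with x obtain m where m: "x \<notin> F (Suc m)" by (cases n) auto
  then have "inv_chart i x \<notin> F m" using assms(1) by auto
  then have "U (inv_chart i x) = S m (inv_chart i x)"
    using U_eq_S[OF inv_chart_in_ball[OF assms(1)]] by simp
  then show ?thesis using U_eq_S[OF x m order_refl] S_Suc_in[OF assms(1), of m] by simp
qed

lemma U_measurable[measurable]: "U \<in> borel_measurable borel"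
  using borel_measurable_integrable[OF U_integrable] by simp

section \<open>Energy of the limit gradient\<close>

lemma nn_integral_unit_ball_finite:
  assumes "\<And>x. norm (f x :: real^'n^'n) \<le> B" "p > 0"
  shows "(\<integral>\<^sup>+x. indicator (ball (0::real^'n) 1) x * ennreal (norm (f x) powr p) \<partial>lborel) < top"
proof -
  have "(\<integral>\<^sup>+x. indicator (ball (0::real^'n) 1) x * ennreal (norm (f x) powr p) \<partial>lborel)
    \<le> (\<integral>\<^sup>+x. ennreal (B powr p) * indicator (ball (0::real^'n) 1) x \<partial>lborel)"
    using assms by (intro nn_integral_mono) (auto simp: indicator_def intro!: ennreal_leI powr_mono2)
  also have "\<dots> = ennreal (B powr p) * emeasure lborel (ball (0::real^'n) 1)"
    by (simp add: nn_integral_cmult_indicator)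
  also have "\<dots> < top"
    using emeasure_lborel_ball_finite[of "0::real^'n" 1] by (simp add: ennreal_mult_less_top)
  finally show ?thesis .
qed

abbreviation energy :: "real \<Rightarrow> (real^'n \<Rightarrow> real^'n^'n) \<Rightarrow> ennreal" where
  "energy p f \<equiv> (\<integral>\<^sup>+x. indicator (ball 0 1) x * ennreal (norm (mat 1 + f x) powr p) \<partial>lborel)"

text \<open>Off the packing only the first block is seen; in the packing the gradient is \<Lambda>
  times a copy, which gives \<open>\<Lambda> powr p\<close> from the scaling and \<open>mass\<close>
  from the volume. Counting the first block on the whole ball only enlarges the bound.\<close>

lemma energy_S_Suc:
  assumes "p > 0"
  shows "energy p (S (Suc m)) \<le> energy p (core_grad \<alpha>) + ennreal (\<Lambda> powr p * mass) * energy p (S m)"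
proof -
  let ?G = "\<lambda>x. ennreal (norm (mat 1 + S (Suc m) x) powr p)"
  let ?g = "\<lambda>x. ennreal (\<Lambda> powr p) * ennreal (norm (mat 1 + S m x) powr p)"
  have "energy p (S (Suc m)) \<le> (\<integral>\<^sup>+x. indicator (ball 0 1) x * ennreal (norm (mat 1 + core_grad \<alpha> x) powr p)
      + indicator \<U> x * ?G x \<partial>lborel)"
    by (intro nn_integral_mono) (auto simp: indicator_def S_Suc_out)
  also have "\<dots> = energy p (core_grad \<alpha>) + (\<integral>\<^sup>+x. indicator \<U> x * ?G x \<partial>lborel)"
    by (rule nn_integral_add) measurable
  also have "(\<integral>\<^sup>+x. indicator \<U> x * ?G x \<partial>lborel) = ennreal mass * (\<integral>\<^sup>+x. indicator (ball 0 1) x * ?g x \<partial>lborel)"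
  proof (rule nn_integral_packing)
    have "?G x = ?g (inv_chart i x)" if "x \<in> ball (a i) (r i)" for x i
      unfolding S_Suc_in[OF that] using \<Lambda>_gt_1 by (simp add: powr_mult ennreal_mult)
    then show "AE x in lborel. \<forall>i. x \<in> ball (a i) (r i) \<longrightarrow> ?G x = ?g (inv_chart i x)"
      by (intro AE_I2) blast
  qed measurable
  also have "(\<integral>\<^sup>+x. indicator (ball 0 1) x * ?g x \<partial>lborel) = ennreal (\<Lambda> powr p) * energy p (S m)"
    by (subst nn_integral_cmult[symmetric], measurable) (simp add: mult_ac)
  also have "ennreal mass * (ennreal (\<Lambda> powr p) * energy p (S m)) = ennreal (\<Lambda> powr p * mass) * energy p (S m)"
    using packing_mass(3) by (simp add: ennreal_mult mult_ac)
  finally show ?thesis .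
qed

text \<open>The recursion is a contraction with ratio q < 1, so the energies of the partial sums
  stay bounded, and Fatou's lemma transfers the bound to the limit.\<close>

lemma energy_U_finite:
  assumes "p > 0" and q: "\<Lambda> powr p * mass < 1"
  shows "energy p U < top"
proof -
  define q where "q = \<Lambda> powr p * mass"
  have q: "0 \<le> q" "q < 1" using q packing_mass(3) by (auto simp: q_def)
  have "energy p (core_grad \<alpha>) < top"
  proof (rule nn_integral_unit_ball_finite[OF _ assms(1)])
    show "norm (mat 1 + core_grad \<alpha> x) \<le> norm (mat 1 :: real^'n^'n) +
        (2 powr \<alpha> * (norm (mat 1 :: real^'n^'n) + \<alpha>) + norm (mat 1 :: real^'n^'n))" for x :: "real^'n"
      using norm_triangle_ineq[of "mat 1" "core_grad \<alpha> x"] core_grad_bounded[of \<alpha> x] \<alpha>_bounds by linarith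
  qed
  moreover have "energy p (S 0) < top"
    by (rule nn_integral_unit_ball_finite[where B="norm (mat 1 :: real^'n^'n)", OF _ assms(1)]) (simp add: S_def)
  ultimately have "energy p (core_grad \<alpha>) + energy p (S 0) < top"
    by simp
  then obtain c where c: "c \<ge> 0" "energy p (core_grad \<alpha>) + energy p (S 0) = ennreal c"
    by (cases "energy p (core_grad \<alpha>) + energy p (S 0)" rule: ennreal_cases) auto
  have c1: "energy p (core_grad \<alpha>) \<le> ennreal c"
    unfolding c(2)[symmetric] by (rule add_increasing2) auto
  have c2: "energy p (S 0) \<le> ennreal c"
    unfolding c(2)[symmetric] by (rule add_increasing) auto
  \<comment> \<open>D is the fixed point of the recursion y = c + q y, and it is at least c, so it
    also bounds the starting energy.\<close>
  define D where "D = c / (1 - q)"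
  have D: "D \<ge> 0" "c + q * D = D" "c \<le> D"
    using q c by (auto simp: D_def field_simps)
  have bd: "energy p (S m) \<le> ennreal D" for m
  proof (induction m)
    case 0
    show ?case using c2 D(3) by (meson ennreal_leI order_trans)
  next
    case (Suc m)
    have "energy p (S (Suc m)) \<le> ennreal c + ennreal q * ennreal D"
      using energy_S_Suc[OF assms(1), of m] add_mono[OF c1 mult_left_mono[OF Suc, of "ennreal q"]]
      unfolding q_def[symmetric] by (meson order_trans zero_le)
    also have "\<dots> = ennreal D"
      using D q c(1) by (metis ennreal_mult ennreal_plus mult_nonneg_nonneg)
    finally show ?case .
  qed
  let ?f = "\<lambda>m x. indicator (ball 0 1) x * ennreal (norm (mat 1 + S m x) powr p)"
  let ?g = "\<lambda>x. indicator (ball 0 1) x * ennreal (norm (mat 1 + U x) powr p)"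
  \<comment> \<open>Off N the sequence is eventually constant, so its lower limit is the limit
    integrand.\<close>
  have "AE x in lborel. ?g x = liminf (\<lambda>m. ?f m x)"
    using AE_not_in[OF N_null]
  proof eventually_elim
    case (elim x)
    then obtain m where m: "x \<notin> F m" by (auto simp: N_def)
    have "?f n x = ?g x" if "n \<ge> m" for n
      using U_eq_S[OF _ m that] by (simp add: indicator_def del: mem_ball)
    then have "(\<lambda>n. ?f n x) \<longlonglongrightarrow> ?g x"
      by (intro tendsto_eventually) (auto simp: eventually_sequentially)
    then show ?case by (intro lim_imp_Liminf[symmetric]) auto
  qed
  then have "energy p U = (\<integral>\<^sup>+x. liminf (\<lambda>m. ?f m x) \<partial>lborel)"
    by (rule nn_integral_cong_AE)
  also have "\<dots> \<le> liminf (\<lambda>m. energy p (S m))"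
    by (rule nn_integral_liminf) measurable
  also have "\<dots> \<le> limsup (\<lambda>m. energy p (S m))"
    by (rule Liminf_le_Limsup) simp
  also have "\<dots> \<le> ennreal D"
    by (rule Limsup_bounded) (simp add: bd)
  also have "\<dots> < top" by simp
  finally show ?thesis .
qed

text \<open>The bracket has determinant 1 - \<alpha> = -1/K, and the power of the norm in front of
  it is positive.\<close>

lemma core_grad_nonzero:
  assumes "1/2 < norm x" "norm x < 1"
  shows "mat 1 + core_grad \<alpha> (x :: real^'n) \<noteq> 0"
proof -
  have "norm (sgn x) = 1" using assms(1) by (auto simp: norm_sgn)
  then have "det (mat 1 - \<alpha> *\<^sub>R outer (sgn x) (sgn x)) \<noteq> 0"
    using \<alpha>_bounds by (simp add: det_mat_minus_outer)
  then have "mat 1 - \<alpha> *\<^sub>R outer (sgn x) (sgn x) \<noteq> 0"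
    using det_0[where 'n='n and 'a=real] by (metis mat_0)
  then show ?thesis using assms by (auto simp: core_grad_def)
qed

text \<open>Self-similarity gives E \<ge> A + \<open>\<Lambda> powr n * mass\<close> E, where A is
  the energy of the outer annulus. The coefficient of E is at least 1 and A is positive, so E cannot
  be finite.\<close>

lemma energy_U_infinite: "energy (CARD('n)) U = top"
proof (rule ccontr)
  let ?p = "real CARD('n)"
  assume fin: "energy ?p U \<noteq> top"
  let ?A = "ball (0::real^'n) 1 - cball 0 (1/2)"
  let ?G = "\<lambda>x. ennreal (norm (mat 1 + U x) powr ?p)"
  let ?g = "\<lambda>x. ennreal (\<Lambda> powr ?p) * ennreal (norm (mat 1 + U x) powr ?p)"
  have [measurable]: "?A \<in> sets borel" by simp
  have UA: "U x = core_grad \<alpha> x" if "x \<in> ?A" for x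
  proof -
    have "x \<notin> \<U>" using that norm_less_if_in_\<U>[of x] by auto
    then have "V k x = 0" if "k \<notin> {0}" for k
      using that by (cases k) (auto simp: pull_out)
    then have "U x = (\<Sum>k\<in>{0}. V k x)"
      unfolding U_def by (intro suminf_finite) auto
    then show ?thesis by simp
  qed
  \<comment> \<open>On the annulus the limit gradient is that of the first block, which is nowhere
    zero, and a nonempty open set is not null.\<close>
  have "(\<integral>\<^sup>+x. indicator ?A x * ?G x \<partial>lborel) \<noteq> 0"
  proof
    assume "(\<integral>\<^sup>+x. indicator ?A x * ?G x \<partial>lborel) = 0"
    then have "AE x in lborel. indicator ?A x * ?G x = 0"
      by (subst (asm) nn_integral_0_iff_AE) measurable
    then have "AE x in lborel. x \<notin> ?A"
    proof eventually_elim
      case (elim x)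
      show ?case
      proof
        assume x: "x \<in> ?A"
        then have "norm (mat 1 + U x) > 0"
          using core_grad_nonzero[of x] UA[OF x] by simp
        then show False using elim x by (simp add: indicator_def)
      qed
    qed
    then have "?A \<in> null_sets lborel"
      by (subst (asm) AE_iff_null_sets[symmetric]) auto
    then have "negligible ?A"
      using negligible_iff_null_sets null_sets_completionI by blast
    moreover have "open ?A" by (simp add: open_Diff)
    ultimately have "?A = {}" using open_not_negligible by blast
    moreover have "(3/4) *\<^sub>R axis undefined 1 \<in> ?A" by simp
    ultimately show False by blast
  qed
  moreover have "(\<integral>\<^sup>+x. indicator ?A x * ?G x \<partial>lborel) + energy ?p U \<le> energy ?p U"
  proof -
    have "1 \<le> \<Lambda> powr ?p * mass"
    proof -
      \<comment> \<open>Since \<alpha> > 1, the scaling at least compensates the volume factor 2^-n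
        at the exponent n.\<close>
      have "\<Lambda> \<ge> 2" using \<alpha>_bounds powr_mono[of 1 \<alpha> 2] by (simp add: \<Lambda>_def)
      then have "2 ^ CARD('n) \<le> \<Lambda> ^ CARD('n)" by (intro power_mono) auto
      then show ?thesis using \<Lambda>_gt_1 by (simp add: mass_eq powr_realpow power_one_over field_simps)
    qed
    then have "1 * energy ?p U \<le> ennreal (\<Lambda> powr ?p * mass) * energy ?p U"
      by (intro mult_right_mono) (auto simp: ennreal_ge_1)
    also have "\<dots> = ennreal mass * (ennreal (\<Lambda> powr ?p) * energy ?p U)"
      using packing_mass(3) by (simp add: ennreal_mult mult_ac)
    also have "\<dots> = ennreal mass * (\<integral>\<^sup>+x. indicator (ball 0 1) x * ?g x \<partial>lborel)"
      by (subst nn_integral_cmult[symmetric], measurable) (simp add: mult_ac)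
    also have "\<dots> = (\<integral>\<^sup>+x. indicator \<U> x * ?G x \<partial>lborel)"
    proof (rule nn_integral_packing[symmetric])
      show "AE x in lborel. \<forall>i. x \<in> ball (a i) (r i) \<longrightarrow> ?G x = ?g (inv_chart i x)"
        using AE_not_in[OF N_null]
      proof eventually_elim
        case (elim x)
        show ?case
        proof (intro allI impI)
          fix i assume i: "x \<in> ball (a i) (r i)"
          show "?G x = ?g (inv_chart i x)"
            unfolding U_self_similar[OF i elim] using \<Lambda>_gt_1 by (simp add: powr_mult ennreal_mult)
        qed
      qed
    qed measurable
    finally have "(\<integral>\<^sup>+x. indicator ?A x * ?G x \<partial>lborel) + energy ?p U
      \<le> (\<integral>\<^sup>+x. indicator ?A x * ?G x \<partial>lborel) + (\<integral>\<^sup>+x. indicator \<U> x * ?G x \<partial>lborel)"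
      by (intro add_left_mono) simp
    also have "\<dots> = (\<integral>\<^sup>+x. indicator ?A x * ?G x + indicator \<U> x * ?G x \<partial>lborel)"
      by (rule nn_integral_add[symmetric]) measurable
    also have "\<dots> \<le> energy ?p U"
      by (intro nn_integral_mono) (auto simp: indicator_def dest: norm_less_if_in_\<U>)
    finally show ?thesis .
  qed
  ultimately show False
    using fin ennreal_add_left_cancel_le[of "energy ?p U" _ 0] by (simp add: add.commute)
qed

end

section \<open>Uniqueness of weak gradients\<close>

fun times_differentiable :: "nat \<Rightarrow> (real \<Rightarrow> real) \<Rightarrow> bool" where
  "times_differentiable 0 f = True"
| "times_differentiable (Suc k) f = (\<exists>f'. (\<forall>x. (f has_real_derivative f' x) (at x)) \<and> times_differentiable k f')"

lemma times_differentiable_cmult: "times_differentiable k f \<Longrightarrow> times_differentiable k (\<lambda>x. c * f x)"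
proof (induction k arbitrary: f)
  case (Suc k)
  then obtain f' where "\<And>x. (f has_real_derivative f' x) (at x)" "times_differentiable k f'" by auto
  then show ?case using Suc.IH[of f'] by (auto intro!: exI[of _ "\<lambda>x. c * f' x"] DERIV_cmult)
qed simp

lemma times_differentiable_add:
  "times_differentiable k f \<Longrightarrow> times_differentiable k g \<Longrightarrow> times_differentiable k (\<lambda>x. f x + g x)"
proof (induction k arbitrary: f g)
  case (Suc k)
  then obtain f' g' where "\<And>x. (f has_real_derivative f' x) (at x)" "times_differentiable k f'"
      "\<And>x. (g has_real_derivative g' x) (at x)" "times_differentiable k g'" by auto
  then show ?case using Suc.IH[of f' g'] by (auto intro!: exI[of _ "\<lambda>x. f' x + g' x"] DERIV_add)
qed simp

lemma times_differentiable_le: "times_differentiable (Suc k) f \<Longrightarrow> times_differentiable k f"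
proof (induction k arbitrary: f)
  case (Suc k)
  then show ?case by (metis times_differentiable.simps(2))
qed simp

lemma times_differentiable_mult:
  "times_differentiable k f \<Longrightarrow> times_differentiable k g \<Longrightarrow> times_differentiable k (\<lambda>x. f x * g x)"
proof (induction k arbitrary: f g)
  case (Suc k)
  then obtain f' g' where fg: "\<And>x. (f has_real_derivative f' x) (at x)" "times_differentiable k f'"
      "\<And>x. (g has_real_derivative g' x) (at x)" "times_differentiable k g'" by auto
  have "times_differentiable k (\<lambda>x. f' x * g x + g' x * f x)"
    by (intro times_differentiable_add Suc.IH fg times_differentiable_le[OF Suc.prems(1)] times_differentiable_le[OF Suc.prems(2)])
  then show ?case
    using fg by (auto intro!: exI[of _ "\<lambda>x. f' x * g x + g' x * f x"] DERIV_mult)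
qed simp

lemma times_differentiable_affine:
  "times_differentiable k f \<Longrightarrow> times_differentiable k (\<lambda>x. f (c * x + d))"
proof (induction k arbitrary: f)
  case (Suc k)
  then obtain f' where f': "\<And>x. (f has_real_derivative f' x) (at x)" "times_differentiable k f'" by auto
  have "((\<lambda>x. f (c * x + d)) has_real_derivative c * f' (c * x + d)) (at x)" for x
    by (rule DERIV_cong[OF DERIV_chain2[OF f'(1)]]) (auto intro!: derivative_eq_intros)
  moreover have "times_differentiable k (\<lambda>x. c * f' (c * x + d))"
    by (intro times_differentiable_cmult Suc.IH f')
  ultimately show ?case by (auto intro!: exI[of _ "\<lambda>x. c * f' (c * x + d)"])
qed simp

text \<open>For m = 0 this is the standard flat function exp(-1/t). The powers of 1/t are included
  so that the family is closed under differentiation up to linear combinations, and smoothness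
  becomes an induction over all m.\<close>

definition exp_flat :: "nat \<Rightarrow> real \<Rightarrow> real" where
  "exp_flat m t = (if t > 0 then (1 / t) ^ m * exp (- (1 / t)) else 0)"

lemma exp_flat_deriv:
  "(exp_flat m has_real_derivative (exp_flat (m + 2) t - real m * exp_flat (m + 1) t)) (at t)"
proof -
  consider "t > 0" | "t < 0" | "t = 0" by linarith
  then show ?thesis
  proof cases
    case 1
    have "((\<lambda>t. (1 / t) ^ m * exp (- (1 / t))) has_real_derivative
        (exp_flat (m + 2) t - real m * exp_flat (m + 1) t)) (at t)"
    proof (rule DERIV_cong)
      show "((\<lambda>t. (1 / t) ^ m * exp (- (1 / t))) has_real_derivative
        (real m * (1 / t) ^ (m - 1) * (- 1 / t\<^sup>2)) * exp (- (1 / t)) + (exp (- (1 / t)) * (1 / t\<^sup>2)) * (1 / t) ^ m) (at t)"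
        using 1 by (auto intro!: derivative_eq_intros simp: power2_eq_square)
      show "(real m * (1 / t) ^ (m - 1) * (- 1 / t\<^sup>2)) * exp (- (1 / t)) + (exp (- (1 / t)) * (1 / t\<^sup>2)) * (1 / t) ^ m
        = exp_flat (m + 2) t - real m * exp_flat (m + 1) t"
        using 1 by (cases m) (auto simp: exp_flat_def power2_eq_square field_simps)
    qed
    then show ?thesis
      by (rule has_field_derivative_transform_within_open[where S="{0<..}"]) (use 1 in \<open>auto simp: exp_flat_def\<close>)
  next
    case 2
    have "((\<lambda>t. 0) has_real_derivative (exp_flat (m + 2) t - real m * exp_flat (m + 1) t)) (at t)"
      using 2 by (simp add: exp_flat_def)
    then show ?thesis
      by (rule has_field_derivative_transform_within_open[where S="{..<0}"]) (use 2 in \<open>auto simp: exp_flat_def\<close>)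
  next
    case 3
    have "((\<lambda>h. (exp_flat m (0 + h) - exp_flat m 0) / h) \<longlongrightarrow> 0) (at 0)"
    proof (rule filterlim_split_at)
      have "((\<lambda>h. 0) \<longlongrightarrow> (0::real)) (at_left 0)" by simp
      moreover have "\<forall>\<^sub>F h in at_left 0. 0 = (exp_flat m (0 + h) - exp_flat m 0) / h"
        by (auto simp: eventually_at_filter exp_flat_def)
      ultimately show "((\<lambda>h. (exp_flat m (0 + h) - exp_flat m 0) / h) \<longlongrightarrow> 0) (at_left 0)"
        by (rule Lim_transform_eventually)
      \<comment> \<open>The right difference quotient at 0 is s^(m+1) / exp(s) with s = 1/h tending
        to infinity.\<close>
      have "((\<lambda>h. inverse h ^ (m + 1) / exp (inverse h)) \<longlongrightarrow> (0::real)) (at_right 0)"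
        by (rule filterlim_compose[OF tendsto_power_div_exp_0 filterlim_inverse_at_top_right])
      moreover have "\<forall>\<^sub>F h in at_right 0. inverse h ^ (m + 1) / exp (inverse h) = (exp_flat m (0 + h) - exp_flat m 0) / h"
        by (auto simp: eventually_at_filter exp_flat_def exp_minus field_simps)
      ultimately show "((\<lambda>h. (exp_flat m (0 + h) - exp_flat m 0) / h) \<longlongrightarrow> 0) (at_right 0)"
        by (rule Lim_transform_eventually)
    qed
    then show ?thesis using 3 by (simp add: DERIV_def exp_flat_def)
  qed
qed

lemma exp_flat_times_differentiable: "times_differentiable k (exp_flat m)"
proof (induction k arbitrary: m)
  case (Suc k)
  have "times_differentiable k (\<lambda>t. exp_flat (m + 2) t + (- real m) * exp_flat (m + 1) t)"
    by (intro times_differentiable_add times_differentiable_cmult Suc)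
  then show ?case
    using exp_flat_deriv[of m] by (auto intro!: exI[of _ "\<lambda>t. exp_flat (m + 2) t - real m * exp_flat (m + 1) t"])
qed simp

text \<open>The derivatives supplied for different orders k coincide by uniqueness, so one function
  \<open>deriv f\<close> inherits every order.\<close>

lemma times_differentiable_deriv:
  assumes "\<And>k. times_differentiable k f"
  shows "(f has_real_derivative deriv f x) (at x)" "times_differentiable k (deriv f)"
proof -
  obtain f' where f': "\<And>x. (f has_real_derivative f' x) (at x)" "times_differentiable k f'"
    using assms[of "Suc k"] by auto
  then have "deriv f = f'" by (auto simp: DERIV_imp_deriv)
  with f' show "(f has_real_derivative deriv f x) (at x)" "times_differentiable k (deriv f)" by auto
qed

text \<open>Coinduction over the class X of products of one-variable functions differentiable to
  every order: the j-th partial derivative replaces the j-th factor by its derivative and stays in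
  the class.\<close>

lemma smooth_fun_prod:
  fixes h :: "'n::finite \<Rightarrow> real \<Rightarrow> real"
  assumes "\<And>i k. times_differentiable k (h i)"
  shows "smooth_fun (\<lambda>x::real^'n. \<Prod>i\<in>UNIV. h i (x $ i))"
proof -
  define X where "X \<phi> \<longleftrightarrow> (\<exists>h. (\<forall>i k. times_differentiable k (h i)) \<and> \<phi> = (\<lambda>x::real^'n. \<Prod>i\<in>UNIV. h i (x $ i)))"
    for \<phi> :: "real^'n \<Rightarrow> real"
  have X: "X (\<lambda>x::real^'n. \<Prod>i\<in>UNIV. h i (x $ i))"
    unfolding X_def using assms by (intro exI[of _ h]) simp
  have step: "(\<forall>x. \<phi> differentiable (at x)) \<and> (\<forall>j. X (partial_deriv \<phi> j))" if X\<phi>: "X \<phi>" for \<phi>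
  proof -
    obtain h where h: "\<And>i k. times_differentiable k (h i)"
      and \<phi>: "\<phi> = (\<lambda>x::real^'n. \<Prod>i\<in>UNIV. h i (x $ i))"
      using X\<phi> unfolding X_def by blast
    have d1: "((\<lambda>x::real^'n. h i (x $ i)) has_derivative (\<lambda>y. deriv (h i) (x $ i) * y $ i)) (at x)" for i x
    proof -
      have "(h i has_derivative (\<lambda>y. deriv (h i) (x $ i) * y)) (at (x $ i))"
        using times_differentiable_deriv(1)[OF h] by (simp add: has_field_derivative_def)
      from has_derivative_compose[OF bounded_linear_imp_has_derivative[OF bounded_linear_vec_nth] this]
      show ?thesis .
    qed
    have d: "(\<phi> has_derivative (\<lambda>y. \<Sum>i\<in>UNIV. (deriv (h i) (x $ i) * y $ i) * (\<Prod>j\<in>UNIV - {i}. h j (x $ j)))) (at x)" for x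
      unfolding \<phi> by (rule has_derivative_prod) (rule d1)
    have "partial_deriv \<phi> j = (\<lambda>x. \<Prod>i\<in>UNIV. (h(j := deriv (h j))) i (x $ i))" for j
    proof
      fix x
      have "partial_deriv \<phi> j x = (\<Sum>i\<in>UNIV. (deriv (h i) (x $ i) * axis j 1 $ i) * (\<Prod>k\<in>UNIV - {i}. h k (x $ k)))"
        unfolding partial_deriv_def frechet_derivative_at[OF d, symmetric] ..
      also have "\<dots> = (\<Sum>i\<in>UNIV. if i = j then deriv (h j) (x $ j) * (\<Prod>k\<in>UNIV - {j}. h k (x $ k)) else 0)"
        by (intro sum.cong) (auto simp: axis_def)
      also have "\<dots> = deriv (h j) (x $ j) * (\<Prod>k\<in>UNIV - {j}. h k (x $ k))" by simp
      also have "\<dots> = (\<Prod>i\<in>UNIV. (h(j := deriv (h j))) i (x $ i))"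
        by (subst prod.remove[of UNIV j]) auto
      finally show "partial_deriv \<phi> j x = (\<Prod>i\<in>UNIV. (h(j := deriv (h j))) i (x $ i))" .
    qed
    moreover have "times_differentiable k ((h(j := deriv (h j))) i)" for i j k
      using h times_differentiable_deriv(2)[OF h] by simp
    ultimately have "X (partial_deriv \<phi> j)" for j
      unfolding X_def by (intro exI[of _ "h(j := deriv (h j))"]) simp
    then show ?thesis using d differentiable_def by blast
  qed
  show ?thesis
    using X by (rule smooth_fun.coinduct) (use step in blast)
qed

text \<open>On the box the functions increase to 1 as \<open>m\<close> grows, so no normalised cut-off is needed.\<close>

definition bump :: "real^'n \<Rightarrow> real^'n \<Rightarrow> nat \<Rightarrow> real^'n \<Rightarrow> real" where
  "bump a b m x = (\<Prod>i\<in>UNIV. exp_flat 0 (real (Suc m) * x $ i + - real (Suc m) * a $ i) *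
     exp_flat 0 (- real (Suc m) * x $ i + real (Suc m) * b $ i))"

lemma exp_flat_0_bounds: "0 \<le> exp_flat 0 t" "exp_flat 0 t \<le> 1"
  by (auto simp: exp_flat_def)

lemma bump_smooth: "smooth_fun (bump a b m)"
  unfolding bump_def[abs_def]
  by (rule smooth_fun_prod)
     (intro times_differentiable_mult times_differentiable_affine exp_flat_times_differentiable)

lemma bump_bounds: "0 \<le> bump a b m x" "bump a b m x \<le> 1"
  unfolding bump_def using exp_flat_0_bounds
  by (auto intro!: prod_nonneg prod_le_1 mult_le_one mult_nonneg_nonneg)

lemma bump_outside:
  assumes "x \<notin> box a b"
  shows "bump a b m x = 0"
proof -
  obtain i where "\<not> (a $ i < x $ i \<and> x $ i < b $ i)"
    using assms by (auto simp: mem_box_cart)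
  then have "real (Suc m) * (x $ i - a $ i) \<le> 0 \<or> real (Suc m) * (b $ i - x $ i) \<le> 0"
    by (auto intro: mult_nonneg_nonpos)
  then have "exp_flat 0 (real (Suc m) * x $ i + - real (Suc m) * a $ i) *
     exp_flat 0 (- real (Suc m) * x $ i + real (Suc m) * b $ i) = 0"
    by (auto simp: exp_flat_def algebra_simps)
  then show ?thesis
    unfolding bump_def by (intro prod_zero) auto
qed

lemma exp_flat_0_tendsto:
  assumes "c > 0"
  shows "(\<lambda>m. exp_flat 0 (real (Suc m) * c)) \<longlonglongrightarrow> 1"
proof -
  have "(\<lambda>m. exp (- (inverse (real (Suc m)) * (1 / c)))) \<longlonglongrightarrow> exp (- (0 * (1 / c)))"
    by (intro tendsto_intros LIMSEQ_inverse_real_of_nat)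
  moreover have "exp_flat 0 (real (Suc m) * c) = exp (- (inverse (real (Suc m)) * (1 / c)))" for m
    using assms by (simp add: exp_flat_def field_simps add_pos_nonneg)
  ultimately show ?thesis by simp
qed

lemma bump_inside:
  assumes "x \<in> box a b"
  shows "(\<lambda>m. bump a b m x) \<longlonglongrightarrow> 1"
proof -
  have ab: "x $ i - a $ i > 0" "b $ i - x $ i > 0" for i
    using assms by (auto simp: mem_box_cart)
  have "(\<lambda>m. \<Prod>i\<in>UNIV. exp_flat 0 (real (Suc m) * (x $ i - a $ i)) * exp_flat 0 (real (Suc m) * (b $ i - x $ i)))
      \<longlonglongrightarrow> (\<Prod>i\<in>(UNIV::'a set). 1 * 1)"
    by (intro tendsto_prod tendsto_mult exp_flat_0_tendsto ab)
  then show ?thesis by (simp add: bump_def algebra_simps)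
qed

lemma bump_test_fun:
  assumes "cbox a b \<subseteq> \<Omega>"
  shows "test_fun \<Omega> (bump a b m)"
proof -
  have "{x. bump a b m x \<noteq> 0} \<subseteq> cbox a b"
    using bump_outside box_subset_cbox by blast
  then have "closure {x. bump a b m x \<noteq> 0} \<subseteq> cbox a b"
    by (rule closure_minimal) (rule closed_cbox)
  then show ?thesis
    unfolding test_fun_def using assms bump_smooth
    by (auto simp: compact_eq_bounded_closed intro: bounded_subset[OF bounded_cbox])
qed

text \<open>Dominated convergence with majorant |w|. Thus the integrals against test functions
  determine the integral over every closed box in \<Omega>.\<close>

lemma integral_bump_tendsto:
  fixes w :: "real^'n \<Rightarrow> real"
  assumes w: "w absolutely_integrable_on cbox a b" and sub: "cbox a b \<subseteq> \<Omega>"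
  shows "(\<lambda>m. integral \<Omega> (\<lambda>x. w x * bump a b m x)) \<longlonglongrightarrow> integral (cbox a b) w"
proof -
  have eq: "integral \<Omega> (\<lambda>x. w x * bump a b m x) = integral (cbox a b) (\<lambda>x. w x * bump a b m x)" for m
  proof -
    have "(\<lambda>x. w x * bump a b m x) = (\<lambda>x. if x \<in> cbox a b then w x * bump a b m x else 0)"
    proof
      fix x
      show "w x * bump a b m x = (if x \<in> cbox a b then w x * bump a b m x else 0)"
        using bump_outside[of x a b m] box_subset_cbox[of a b] by (cases "x \<in> box a b") auto
    qed
    then have "integral \<Omega> (\<lambda>x. w x * bump a b m x) = integral (cbox a b \<inter> \<Omega>) (\<lambda>x. w x * bump a b m x)"
      using Henstock_Kurzweil_Integration.integral_restrict_Int[of \<Omega> "cbox a b" "\<lambda>x. w x * bump a b m x"] by simp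
    also have "cbox a b \<inter> \<Omega> = cbox a b" using sub by blast
    finally show ?thesis .
  qed
  \<comment> \<open>The bumps vanish on the faces of the box, so the pointwise limit lives on the
    open box; the faces do not change the integral.\<close>
  let ?g = "\<lambda>x. if x \<in> box a b then w x else 0"
  have "(\<lambda>m. integral (cbox a b) (\<lambda>x. w x * bump a b m x)) \<longlonglongrightarrow> integral (cbox a b) ?g"
  proof (rule dominated_convergence(2))
    show "(\<lambda>x. w x * bump a b m x) integrable_on cbox a b" for m
    proof -
      have "continuous_on UNIV (bump a b m)"
        by (intro continuous_at_imp_continuous_on ballI differentiable_imp_continuous_within
            smooth_fun_differentiable bump_smooth)
      then have "bump a b m \<in> borel_measurable (lebesgue_on (cbox a b))"
        by (intro continuous_imp_measurable_on_sets_lebesgue) (auto intro: continuous_on_subset)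
      then have "(\<lambda>x. bump a b m x * w x) absolutely_integrable_on cbox a b"
        using w bump_bounds[of a b m]
        by (intro absolutely_integrable_bounded_measurable_product[OF bilinear_times])
           (auto intro!: boundedI[of _ 1] simp: abs_of_nonneg)
      then show ?thesis
        using set_lebesgue_integral_eq_integral(1) by (simp add: mult.commute)
    qed
    show "(\<lambda>x. \<bar>w x\<bar>) integrable_on cbox a b"
      using w by (simp add: absolutely_integrable_on_def)
    show "norm (w x * bump a b m x) \<le> \<bar>w x\<bar>" for m x
      using bump_bounds[of a b m x] by (simp add: abs_mult mult_left_le)
    show "(\<lambda>m. w x * bump a b m x) \<longlonglongrightarrow> ?g x" for x
    proof (cases "x \<in> box a b")
      case True
      then show ?thesis using tendsto_mult[OF tendsto_const bump_inside[OF True], of "w x"] by simp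
    qed (simp add: bump_outside)
  qed
  also have "integral (cbox a b) ?g = integral (box a b \<inter> cbox a b) w"
    by (rule Henstock_Kurzweil_Integration.integral_restrict_Int)
  also have "box a b \<inter> cbox a b = box a b" using box_subset_cbox by blast
  finally show ?thesis by (simp only: eq integral_open_interval)
qed

text \<open>Lebesgue differentiation along small cubes with corner x: almost everywhere w is the
  limit of averages, and all of these are zero.\<close>

lemma zero_box_integrals_imp_zero:
  fixes w :: "real^'n \<Rightarrow> real"
  assumes "w absolutely_integrable_on cbox a b"
    and z: "\<And>c d. cbox c d \<subseteq> cbox a b \<Longrightarrow> integral (cbox c d) w = 0"
  shows "negligible {x \<in> cbox a b. w x \<noteq> 0}"
proof -
  let ?f = "\<lambda>x. if x \<in> cbox a b then w x else 0"
  have "?f absolutely_integrable_on UNIV"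
    using assms(1) by (simp add: absolutely_integrable_restrict_UNIV)
  then have "?f integrable_on UNIV"
    by (rule set_lebesgue_integral_eq_integral(1))
  then have "?f integrable_on cbox c d" for c d
    by (rule integrable_on_subcbox) simp
  then obtain N where N: "negligible N"
    "\<And>x e. \<lbrakk>x \<notin> N; 0 < e\<rbrakk> \<Longrightarrow> \<exists>d>0. \<forall>h. 0 < h \<and> h < d \<longrightarrow>
         norm (integral (cbox x (x + h *\<^sub>R One)) ?f /\<^sub>R h ^ DIM(real^'n) - ?f x) < e"
    using integrable_ccontinuous_explicit[of ?f] by blast
  have "w x = 0" if x: "x \<in> box a b" "x \<notin> N" for x
  proof (rule ccontr)
    assume "w x \<noteq> 0"
    then have "\<bar>w x\<bar> > 0" by simp
    from N(2)[OF x(2) this] obtain d where d: "d > 0"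
      "\<And>h. 0 < h \<Longrightarrow> h < d \<Longrightarrow> norm (integral (cbox x (x + h *\<^sub>R One)) ?f /\<^sub>R h ^ DIM(real^'n) - ?f x) < \<bar>w x\<bar>"
      by blast
    obtain e where e: "e > 0" "ball x e \<subseteq> box a b"
      using x(1) open_box open_contains_ball by blast
    define nn where "nn = norm (One :: real^'n)"
    have nn: "nn \<ge> 0" by (simp add: nn_def)
    \<comment> \<open>The diagonal of the cube has length h times the norm of \<open>One\<close>;
      this choice keeps it below e, so the cube stays in the box. Adding 1 keeps the denominator
      positive.\<close>
    define h where "h = min (d / 2) (e / (2 * (nn + 1)))"
    have h: "0 < h" "h < d" using d(1) e(1) nn by (auto simp: h_def)
    have "h * nn \<le> e / (2 * (nn + 1)) * nn"
      using nn by (intro mult_right_mono) (auto simp: h_def)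
    also have "\<dots> < e" using e(1) nn by (simp add: field_simps) (smt (verit) mult_nonneg_nonneg)
    finally have hn: "h * nn < e" .
    have xh: "x \<in> box a b" "x + h *\<^sub>R One \<in> box a b"
      using x(1) e(2) hn h(1) by (auto simp: nn_def dist_norm subset_iff)
    have sub: "cbox x (x + h *\<^sub>R One) \<subseteq> cbox a b"
      using xh box_subset_cbox[of a b] by (intro subset_box_imp(1)) (auto simp: mem_box less_imp_le)
    have "integral (cbox x (x + h *\<^sub>R One)) ?f = integral (cbox x (x + h *\<^sub>R One)) w"
      using sub by (intro Henstock_Kurzweil_Integration.integral_cong) auto
    also have "\<dots> = 0" by (rule z[OF sub])
    finally have "norm (0 - ?f x) < \<bar>w x\<bar>" using d(2)[OF h] by simp
    moreover have "?f x = w x" using x(1) box_subset_cbox[of a b] by auto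
    ultimately show False by simp
  qed
  then have "{x \<in> cbox a b. w x \<noteq> 0} \<subseteq> N \<union> (cbox a b - box a b)" by blast
  moreover have "negligible (N \<union> (cbox a b - box a b))"
    by (intro negligible_Un N(1) negligible_frontier_interval)
  ultimately show ?thesis using negligible_subset by blast
qed

lemma absolutely_integrable_matrix_component:
  fixes G :: "real^'n \<Rightarrow> real^'n^'n"
  assumes "G absolutely_integrable_on C"
  shows "(\<lambda>x. G x $ i $ j) absolutely_integrable_on C"
  using absolutely_integrable_linear[OF assms bounded_linear_compose[OF bounded_linear_vec_nth[of j] bounded_linear_vec_nth[of i]]]
  by (simp add: o_def)

text \<open>Testing with bumps shows that the entries of both gradients have equal integrals over
  all closed boxes in \<Omega>, so they agree almost everywhere on each box, and countably many
  boxes fill the open set.\<close>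

lemma weak_grad_unique:
  fixes f :: "real^'n \<Rightarrow> real^'n"
  assumes G: "weak_grad f G \<Omega>" and G': "weak_grad f G' \<Omega>" and "open \<Omega>"
  shows "negligible {x \<in> \<Omega>. G x \<noteq> G' x}"
proof -
  have neg: "negligible {x \<in> cbox a b. G x \<noteq> G' x}" if sub: "cbox a b \<subseteq> \<Omega>" for a b
  proof -
    have ai: "(\<lambda>x. G x $ i $ j) absolutely_integrable_on cbox c d" "(\<lambda>x. G' x $ i $ j) absolutely_integrable_on cbox c d"
      if "cbox c d \<subseteq> \<Omega>" for i j c d
      using G G' that unfolding weak_grad_def
      by (auto intro!: absolutely_integrable_matrix_component)
    have "negligible {x \<in> cbox a b. G x $ i $ j - G' x $ i $ j \<noteq> 0}" for i j
    proof (rule zero_box_integrals_imp_zero)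
      show "(\<lambda>x. G x $ i $ j - G' x $ i $ j) absolutely_integrable_on cbox a b"
        by (intro set_integral_diff(1) ai sub)
      fix c d assume "cbox c d \<subseteq> cbox a b"
      then have cd: "cbox c d \<subseteq> \<Omega>" using sub by blast
      have "integral \<Omega> (\<lambda>x. G x $ i $ j * bump c d m x) = integral \<Omega> (\<lambda>x. G' x $ i $ j * bump c d m x)" for m
      proof -
        have "integral \<Omega> (\<lambda>x. f x $ i * partial_deriv (bump c d m) j x) = - integral \<Omega> (\<lambda>x. G x $ i $ j * bump c d m x)"
          using G bump_test_fun[OF cd, of m] unfolding weak_grad_def by blast
        moreover have "integral \<Omega> (\<lambda>x. f x $ i * partial_deriv (bump c d m) j x) = - integral \<Omega> (\<lambda>x. G' x $ i $ j * bump c d m x)"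
          using G' bump_test_fun[OF cd, of m] unfolding weak_grad_def by blast
        ultimately show ?thesis by linarith
      qed
      then have "integral (cbox c d) (\<lambda>x. G x $ i $ j) = integral (cbox c d) (\<lambda>x. G' x $ i $ j)"
        using LIMSEQ_unique[OF integral_bump_tendsto[OF ai(1)[OF cd] cd, of i j]] integral_bump_tendsto[OF ai(2)[OF cd] cd, of i j]
        by presburger
      then show "integral (cbox c d) (\<lambda>x. G x $ i $ j - G' x $ i $ j) = 0"
        using ai[OF cd, of i j] by (subst Henstock_Kurzweil_Integration.integral_diff) (auto simp: absolutely_integrable_on_def)
    qed
    then have "negligible (\<Union>i. \<Union>j. {x \<in> cbox a b. G x $ i $ j - G' x $ i $ j \<noteq> 0})"
      by (intro negligible_Union) auto
    then show ?thesis
      by (rule negligible_subset) (auto simp: vec_eq_iff)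
  qed
  obtain D where D: "countable D" "D \<subseteq> Pow \<Omega>" "\<And>X. X \<in> D \<Longrightarrow> \<exists>a b. X = cbox a b" "\<Union>D = \<Omega>"
    by (rule open_countable_Union_open_cbox[OF \<open>open \<Omega>\<close>], rule that; assumption)
  have "{x \<in> \<Omega>. G x \<noteq> G' x} = (\<Union>X\<in>D. {x \<in> X. G x \<noteq> G' x})"
    using D(4) by blast
  moreover have "negligible {x \<in> X. G x \<noteq> G' x}" if "X \<in> D" for X
    using D(2) D(3)[OF that] neg that by blast
  then have "negligible (\<Union>X\<in>D. {x \<in> X. G x \<noteq> G' x})"
    using D(1) by (intro negligible_countable_Union) auto
  ultimately show ?thesis by simp
qed

section \<open>Proof of the theorem\<close>

lemma integral_zero_outside:
  fixes g :: "real^'n \<Rightarrow> real"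
  assumes "\<And>x. x \<notin> \<Omega> \<Longrightarrow> g x = 0" "integrable lborel g"
  shows "integral \<Omega> g = (\<integral>x. g x \<partial>lborel)"
proof -
  have "g = (\<lambda>x. if x \<in> \<Omega> then g x else 0)" using assms(1) by auto
  then have "integral UNIV g = integral \<Omega> g"
    using Henstock_Kurzweil_Integration.integral_restrict_Int[of UNIV \<Omega> g] by simp
  then show ?thesis using integral_lborel[OF assms(2)] by simp
qed

lemma loc_int_absolutely_integrable:
  assumes "loc_int f" "compact C"
  shows "f absolutely_integrable_on C"
proof -
  have [measurable]: "f \<in> borel_measurable borel" using assms(1) by (rule loc_int_measurable)
  have C: "C \<in> sets borel" using assms(2) by (simp add: borel_compact)
  obtain R where "C \<subseteq> cball 0 R"
    using compact_imp_bounded[OF assms(2)] by (auto simp: bounded_iff subset_iff)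
  then have "set_integrable lborel C f"
    using assms(1) C unfolding loc_int_def by (auto intro: set_integrable_subset)
  then show ?thesis
    using C by (simp add: set_integrable_def integrable_completion)
qed

text \<open>A test function supported in \<Omega> is a C1 test on the whole space, and both
  integrands vanish off \<Omega>; the scalar identities are the entries of the matrix
  identity.\<close>

lemma weak_der_imp_weak_grad:
  fixes f :: "real^'n \<Rightarrow> real^'n"
  assumes wd: "weak_der f G" and f: "loc_int f" and G: "loc_int G"
  shows "weak_grad f G \<Omega>"
  unfolding weak_grad_def
proof (intro conjI allI impI)
  show "f absolutely_integrable_on C" "G absolutely_integrable_on C" if "compact C \<and> C \<subseteq> \<Omega>" for C
    using that loc_int_absolutely_integrable f G by auto
  fix \<phi> i j assume t: "test_fun \<Omega> \<phi>"
  let ?D = "\<lambda>x. \<chi> j. partial_deriv \<phi> j x"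
  have c: "C1_test \<phi> ?D" by (rule test_fun_C1_test(1)[OF t])
  have out: "\<phi> x = 0" "?D x = 0" if "x \<notin> \<Omega>" for x
    using that t test_fun_C1_test(2)[OF t, of x] closure_subset[of "{x. \<phi> x \<noteq> 0}"]
    unfolding test_fun_def by blast+
  have bl: "bounded_linear (\<lambda>A::real^'n^'n. A $ i $ j)"
    using bounded_linear_compose[OF bounded_linear_vec_nth bounded_linear_vec_nth] .
  have io: "integrable lborel (\<lambda>x. outer (f x) (?D x))" by (rule C1_test_integrable_outer[OF c f])
  have ip: "integrable lborel (\<lambda>x. \<phi> x *\<^sub>R G x)" by (rule C1_test_integrable[OF c G])
  have e1: "(\<lambda>x. outer (f x) (?D x) $ i $ j) = (\<lambda>x. f x $ i * partial_deriv \<phi> j x)"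
    by (simp add: outer_nth)
  have e2: "(\<lambda>x. (\<phi> x *\<^sub>R G x) $ i $ j) = (\<lambda>x. G x $ i $ j * \<phi> x)"
    by (simp add: mult.commute)
  have "integral \<Omega> (\<lambda>x. f x $ i * partial_deriv \<phi> j x) = (\<integral>x. f x $ i * partial_deriv \<phi> j x \<partial>lborel)"
  proof (rule integral_zero_outside)
    show "f x $ i * partial_deriv \<phi> j x = 0" if "x \<notin> \<Omega>" for x
      using out(2)[OF that] by (simp add: vec_eq_iff)
    show "integrable lborel (\<lambda>x. f x $ i * partial_deriv \<phi> j x)"
      using integrable_bounded_linear[OF bl io] unfolding e1 .
  qed
  also have "\<dots> = (\<integral>x. outer (f x) (?D x) \<partial>lborel) $ i $ j"
    using integral_bounded_linear[OF bl io] unfolding e1 by simp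
  also have "\<dots> = - ((\<integral>x. \<phi> x *\<^sub>R G x \<partial>lborel) $ i $ j)"
    using wd c unfolding weak_der_def by simp
  also have "(\<integral>x. \<phi> x *\<^sub>R G x \<partial>lborel) $ i $ j = (\<integral>x. G x $ i $ j * \<phi> x \<partial>lborel)"
    using integral_bounded_linear[OF bl ip] unfolding e2 by simp
  also have "\<dots> = integral \<Omega> (\<lambda>x. G x $ i $ j * \<phi> x)"
  proof (rule integral_zero_outside[symmetric])
    show "G x $ i $ j * \<phi> x = 0" if "x \<notin> \<Omega>" for x
      using out(1)[OF that] by simp
    show "integrable lborel (\<lambda>x. G x $ i $ j * \<phi> x)"
      using integrable_bounded_linear[OF bl ip] unfolding e2 .
  qed
  finally show "integral \<Omega> (\<lambda>x. f x $ i * partial_deriv \<phi> j x) = - integral \<Omega> (\<lambda>x. G x $ i $ j * \<phi> x)" .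
qed

lemma Lp_on_if_nn_integral:
  fixes g :: "real^'n \<Rightarrow> 'b::euclidean_space"
  assumes [measurable]: "g \<in> borel_measurable borel" "S \<in> sets borel"
    and fin: "(\<integral>\<^sup>+x. indicator S x * ennreal (norm (g x) powr p) \<partial>lborel) < top"
  shows "Lp_on p S g"
  unfolding Lp_on_def
proof
  have "g \<in> borel_measurable lebesgue"
    by (rule measurable_completion) simp
  then show "g measurable_on S"
    by (subst measurable_on_iff_borel_measurable) (auto intro: measurable_restrict_space1)
  have "integrable lborel (\<lambda>x. indicator S x * norm (g x) powr p)"
  proof (rule integrableI_bounded)
    have "(\<integral>\<^sup>+x. ennreal (norm (indicator S x * norm (g x) powr p)) \<partial>lborel)
      = (\<integral>\<^sup>+x. indicator S x * ennreal (norm (g x) powr p) \<partial>lborel)"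
      by (intro nn_integral_cong) (auto simp: indicator_def)
    then show "(\<integral>\<^sup>+x. ennreal (norm (indicator S x * norm (g x) powr p)) \<partial>lborel) < \<infinity>"
      using fin by simp
  qed measurable
  then have "(\<lambda>x. indicator S x * norm (g x) powr p) integrable_on UNIV"
    by (rule integrable_on_lborel)
  moreover have "(\<lambda>x. indicator S x * norm (g x) powr p) = (\<lambda>x. if x \<in> S then norm (g x) powr p else 0)"
    by (auto simp: indicator_def)
  ultimately show "(\<lambda>x. norm (g x) powr p) integrable_on S"
    by (simp only: integrable_restrict_UNIV)
qed

text \<open>A gauge integral ignores null sets, and for nonnegative functions integrability in that
  sense means a finite Lebesgue integral. This moves L^n bounds from an arbitrary weak gradient to
  the constructed one.\<close>

lemma nn_integral_finite_if_Lp_on: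
  fixes g g' :: "real^'n \<Rightarrow> 'b::euclidean_space"
  assumes [measurable]: "g \<in> borel_measurable borel" "S \<in> sets borel"
    and Lp: "Lp_on p S g'" and neg: "negligible {x \<in> S. g x \<noteq> g' x}"
  shows "(\<integral>\<^sup>+x. indicator S x * ennreal (norm (g x) powr p) \<partial>lborel) < top"
proof -
  have g': "(\<lambda>x. norm (g' x) powr p) integrable_on S"
    using Lp by (simp add: Lp_on_def)
  have "(\<lambda>x. norm (g x) powr p) integrable_on S"
    by (rule integrable_spike[OF g' neg]) auto
  then have "(\<lambda>x. if x \<in> S then norm (g x) powr p else 0) integrable_on UNIV"
    by (simp only: integrable_restrict_UNIV)
  then obtain y where "((\<lambda>x. if x \<in> S then norm (g x) powr p else 0) has_integral y) UNIV"
    by blast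
  then have "(\<integral>\<^sup>+x. ennreal (if x \<in> S then norm (g x) powr p else 0) \<partial>lebesgue) = ennreal y"
    by (subst (asm) has_integral_iff_nn_integral_lebesgue) auto
  then have "(\<integral>\<^sup>+x. ennreal (if x \<in> S then norm (g x) powr p else 0) \<partial>lborel) = ennreal y"
    by (simp add: nn_integral_completion)
  moreover have "(\<integral>\<^sup>+x. ennreal (if x \<in> S then norm (g x) powr p else 0) \<partial>lborel)
      = (\<integral>\<^sup>+x. indicator S x * ennreal (norm (g x) powr p) \<partial>lborel)"
    by (intro nn_integral_cong) (auto simp: indicator_def)
  ultimately show ?thesis by simp
qed

lemma weak_der_ident: "weak_der (\<lambda>x::real^'n. x) (\<lambda>x. mat 1)"
  by (rule weak_der_lipschitz[where L=1 and B="norm (mat 1 :: real^'n^'n)"]) auto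

theorem theorem1p1:
  fixes \<Omega> :: "(real^'n) set" and K p :: real
  assumes "CARD('n) \<ge> 3"
    and "K \<ge> 1"
    and "open \<Omega>" and "connected \<Omega>" and "\<Omega> \<noteq> {}" and "bounded \<Omega>"
    and "1 < p" and "p < real CARD('n) * K / (K + 1)"
  shows "\<exists>f :: real^'n \<Rightarrow> real^'n.
           sobolev p \<Omega> f \<and> continuous_on \<Omega> f \<and> bounded (f ` \<Omega>) \<and>
           weakly_qr K \<Omega> f \<and> \<not> quasiregular \<Omega> f"
proof -
  \<comment> \<open>The largest \<delta> with \<Lambda> \<delta> \<le> 1/2.\<close>
  define \<delta> where "\<delta> = 1 / (2 * 2 powr (1 + 1 / K))"
  have "\<delta> > 0" by (simp add: \<delta>_def)
  then obtain a r where ar: "ball_packing a r (ball (0::real^'n) (1/2)) \<delta>"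
    using ball_packing_exists[of "ball (0::real^'n) (1/2)" \<delta>] by auto
  obtain b s where bs: "ball_packing b s \<Omega> 1"
    using ball_packing_exists[OF assms(3,6), of 1] by auto
  interpret Q: qr_iteration a r \<delta> K
    using ar assms(1,2) by (auto simp: qr_iteration_def qr_iteration_axioms_def \<delta>_def)
  interpret P: ball_packing b s \<Omega> 1 by (rule bs)
  \<comment> \<open>On the ball with centre b and radius s this is b + s (y + u y) with y = (x -
    b)/s, a similar copy of the limit map; off the balls it is the identity.\<close>
  define f where "f x = x + P.lift Q.u x" for x
  define G where "G x = mat 1 + P.pull Q.U x" for x

  have cl: "continuous_on UNIV (P.lift Q.u)"
    by (rule P.lift_continuous[OF Q.u_continuous Q.u_zero Q.u_bound])
  have cf: "continuous_on UNIV f"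
    unfolding f_def[abs_def] by (intro continuous_intros cl)
  have ipull: "integrable lborel (P.pull Q.U)"
    by (rule P.integral_norm_pull(1)[OF Q.U_integrable Q.U_zero])
  have li: "loc_int (\<lambda>x::real^'n. mat 1 :: real^'n^'n)"
    by (intro loc_int_continuous continuous_intros)
  have wd: "weak_der f G"
    unfolding f_def[abs_def] G_def[abs_def]
  proof (rule weak_der_add[OF weak_der_ident])
    show "weak_der (P.lift Q.u) (P.pull Q.U)"
      by (rule P.weak_der_lift[OF Q.weak_der_u Q.u_integrable Q.U_integrable Q.u_zero Q.U_zero])
  qed (intro loc_int_continuous loc_int_integrable cl ipull continuous_intros)+
  have Gm[measurable]: "G \<in> borel_measurable borel"
    unfolding G_def[abs_def] by measurable
  have lG: "loc_int G"
    unfolding loc_int_def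
  proof (intro conjI allI Gm)
    show "set_integrable lborel (cball 0 R) G" for R
      using li loc_int_integrable[OF ipull] unfolding G_def[abs_def] loc_int_def
      by (intro set_integral_add(1)) auto
  qed
  have wg: "weak_grad f G \<Omega>"
    by (rule weak_der_imp_weak_grad[OF wd loc_int_continuous[OF cf] lG])
  obtain R where R: "\<And>x. x \<in> \<Omega> \<Longrightarrow> norm x \<le> R"
    using assms(6) by (auto simp: bounded_iff)
  have lb: "norm (P.lift Q.u x) \<le> 1 * (2 * Q.\<Lambda>)" for x
    by (rule P.lift_norm_le[OF Q.u_zero Q.u_bound])
  have fb: "norm (f x) \<le> R + 2 * Q.\<Lambda>" if "x \<in> \<Omega>" for x
    using R[OF that] lb[of x] norm_triangle_ineq[of x "P.lift Q.u x"]
    by (simp add: f_def)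
  have G_in: "G x = mat 1 + Q.U (P.inv_chart i x)" if "x \<in> ball (b i) (s i)" for i x
    using P.pull_in[OF that] by (simp add: G_def)

  have Lpf: "Lp_on p \<Omega> f"
  proof (rule Lp_on_if_nn_integral)
    have "(\<integral>\<^sup>+x. indicator \<Omega> x * ennreal (norm (f x) powr p) \<partial>lborel)
      \<le> (\<integral>\<^sup>+x. ennreal ((R + 2 * Q.\<Lambda>) powr p) * indicator \<Omega> x \<partial>lborel)"
      using fb assms(7) by (intro nn_integral_mono) (auto simp: indicator_def intro!: ennreal_leI powr_mono2)
    also have "\<dots> = ennreal ((R + 2 * Q.\<Lambda>) powr p) * emeasure lborel \<Omega>"
      using assms(3) by (intro nn_integral_cmult_indicator) simp
    also have "\<dots> < top"
      using emeasure_bounded_finite[OF assms(6)] by (simp add: ennreal_mult_less_top)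
    finally show "(\<integral>\<^sup>+x. indicator \<Omega> x * ennreal (norm (f x) powr p) \<partial>lborel) < top" .
  qed (use assms(3) cf in \<open>auto intro: borel_measurable_continuous_onI\<close>)
  have LpG: "Lp_on p \<Omega> G"
  proof (rule Lp_on_if_nn_integral)
    have "(\<integral>\<^sup>+x. indicator \<Omega> x * ennreal (norm (G x) powr p) \<partial>lborel)
      = (\<integral>\<^sup>+x. indicator P.\<U> x * ennreal (norm (G x) powr p) \<partial>lborel)"
    proof (rule nn_integral_cong_AE, use AE_not_in[OF P.null_uncovered] in eventually_elim)
      case (elim x)
      then show ?case using P.\<U>_subset by (auto simp: indicator_def)
    qed
    also have "\<dots> = ennreal P.mass * Q.energy p Q.U"
    proof (rule P.nn_integral_packing)
      show "AE x in lborel. \<forall>i. x \<in> ball (b i) (s i) \<longrightarrow>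
          ennreal (norm (G x) powr p) = ennreal (norm (mat 1 + Q.U (P.inv_chart i x)) powr p)"
        using G_in by (intro AE_I2) metis
    qed measurable
    also have "\<dots> < top"
    proof -
      \<comment> \<open>This is the upper bound on p multiplied by (K + 1)/K; it says exactly that
        \<open>\<Lambda> powr p * mass\<close> is below 1.\<close>
      have "(1 + 1 / K) * p < CARD('n)"
        using assms(2,8) by (simp add: field_simps)
      then have "2 powr ((1 + 1 / K) * p) < 2 powr CARD('n)"
        by simp
      then have "Q.\<Lambda> powr p * Q.mass < 1"
        by (simp add: Q.\<Lambda>_def Q.\<alpha>_def Q.mass_eq powr_powr powr_realpow power_one_over field_simps)
      then have "Q.energy p Q.U < top"
        using assms(7) by (intro Q.energy_U_finite) auto
      then show ?thesis by (simp add: ennreal_mult_less_top)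
    qed
    finally show "(\<integral>\<^sup>+x. indicator \<Omega> x * ennreal (norm (G x) powr p) \<partial>lborel) < top" .
  qed (use assms(3) in auto)

  \<comment> \<open>Two null sets are discarded: the part of \<Omega> missed by the balls, and the
    copies of the exceptional set N in all of them.\<close>
  have "AE x in lborel. x \<in> \<Omega> \<longrightarrow> qr_cone K (G x)"
    using AE_not_in[OF P.null_uncovered] P.AE_inv_chart[OF Q.N_null]
  proof eventually_elim
    case (elim x)
    show ?case
    proof
      assume "x \<in> \<Omega>"
      then obtain i where i: "x \<in> ball (b i) (s i)" using elim(1) by (auto simp: P.\<U>_def)
      then show "qr_cone K (G x)"
        using G_in[OF i] Q.U_qr_cone[OF P.inv_chart_in_ball[OF i]] elim(2) by auto
    qed
  qed
  then have qc: "AE x in lebesgue. x \<in> \<Omega> \<longrightarrow> qr_cone K (G x)"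
    by (rule AE_completion)
  have wq: "weakly_qr K \<Omega> f"
    unfolding weakly_qr_def
  \<comment> \<open>The second alternative is chosen because every copy of the limit map reverses
    orientation.\<close>
  proof (intro conjI assms(2) exI[of _ G] wg disjI2)
    show "AE x in lebesgue. x \<in> \<Omega> \<longrightarrow> det (G x) \<le> 0"
      using qc by eventually_elim (auto simp: qr_cone_def)
    show "AE x in lebesgue. x \<in> \<Omega> \<longrightarrow>
        (\<forall>\<xi> \<eta>. norm \<xi> = 1 \<and> norm \<eta> = 1 \<longrightarrow> norm (G x *v \<xi>) \<le> K * norm (G x *v \<eta>))"
      using qc by eventually_elim (auto simp: qr_cone_def)
  qed

  have "\<not> quasiregular \<Omega> f"
  proof
    assume "quasiregular \<Omega> f"
    then obtain G' where G': "weak_grad f G' \<Omega>"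
      and Lp: "\<And>C. compact C \<Longrightarrow> C \<subseteq> \<Omega> \<Longrightarrow> Lp_on (CARD('n)) C G'"
      unfolding quasiregular_def quasiregular_K_def sobolev_loc_def by blast
    \<comment> \<open>A packing may contain empty balls; one of positive radius exists because a
      nonempty open set is not negligible.\<close>
    obtain i where i: "s i > 0"
    proof -
      have "P.\<U> \<noteq> {}"
      proof
        assume "P.\<U> = {}"
        then have "negligible \<Omega>" using P.cover unfolding P.\<U>_def[symmetric] by simp
        then show False using open_not_negligible assms(3,5) by blast
      qed
      then show ?thesis using that P.ball_imp_r_pos unfolding P.\<U>_def by blast
    qed
    \<comment> \<open>Local integrability is tested on compact sets, so the closed ball is used;
      packings keep closed balls inside the set for this purpose.\<close>
    let ?C = "cball (b i) (s i)"
    let ?g = "\<lambda>x. ennreal (norm (mat 1 + Q.U x) powr CARD('n))"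
    have C: "?C \<subseteq> \<Omega>" by (rule P.cball_sub[OF i])
    have "(\<integral>\<^sup>+x. indicator ?C x * ennreal (norm (G x) powr CARD('n)) \<partial>lborel) < top"
    proof (rule nn_integral_finite_if_Lp_on)
      show "Lp_on (CARD('n)) ?C G'" by (rule Lp[OF compact_cball C])
      show "negligible {x \<in> ?C. G x \<noteq> G' x}"
        by (rule negligible_subset[OF weak_grad_unique[OF wg G' assms(3)]]) (use C in blast)
    qed auto
    moreover have "(\<integral>\<^sup>+x. indicator (ball (b i) (s i)) x * ?g (P.inv_chart i x) \<partial>lborel)
        \<le> (\<integral>\<^sup>+x. indicator ?C x * ennreal (norm (G x) powr CARD('n)) \<partial>lborel)"
      using G_in[of _ i] by (intro nn_integral_mono) (auto simp: indicator_def)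
    \<comment> \<open>The change of variables multiplies the infinite energy by the positive number
      \<open>s i ^ CARD('n)\<close>, so a single ball already contradicts L^n integrability.\<close>
    moreover have "(\<integral>\<^sup>+x. indicator (ball (b i) (s i)) x * ?g (P.inv_chart i x) \<partial>lborel)
        = ennreal (s i ^ CARD('n)) * Q.energy (CARD('n)) Q.U"
      by (rule P.nn_integral_ball) measurable
    moreover have "\<dots> = top"
      using i by (simp add: Q.energy_U_infinite ennreal_mult_top)
    ultimately show False by (simp add: top_unique)
  qed
  moreover have "sobolev p \<Omega> f"
    unfolding sobolev_def using wg Lpf LpG by blast
  moreover have "bounded (f ` \<Omega>)"
    using fb by (auto simp: bounded_iff)
  ultimately show ?thesis
    using wq continuous_on_subset[OF cf subset_UNIV] by blast
qed

end
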